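(* Let $K$ be a discrete field. Every finitely presented $K$-algebra that is net (unramified) is strictly finite over $K$ (i.e. it has a finite basis as a $K$-vector space) and is trace-étale over $K$. In summary, a finitely presented $K$-algebra is net if and only if it is trace-étale.
   Context: All rings and algebras are commutative with unit. A discrete field is a nonzero commutative ring in which every element is zero or invertible. All $K$-algebras are assumed finitely presented. Let $A=K[X_1,\dots,X_n]/\langle f_1,\dots,f_s\rangle$ be a finitely presented $K$-algebra. Let $\mathrm{Ja}:A^s\to A^n$ be the $A$-linear map whose matrix is the transpose of the Jacobian matrix $(\partial f_i/\partial X_j)_{1\le i\le s,\,1\le j\le n}$ evaluated in $A$. The module of Kähler differentials is $\Omega_{A/K}=\mathrm{Coker}(\mathrm{Ja})$ (it is canonically the target of the universal $K$-derivation of $A$). The algebra $A$ is called net (or unramified) over $K$ if $\Omega_{A/K}=0$, i.e. $\mathrm{Ja}$ is surjective. A $K$-algebra is strictly finite if it has a finite basis as a $K$-vector space. A $K$-algebra $A$ with a finite basis $(b_1,\dots,b_m)$ as a $K$-vector space is called trace-étale (over $K$) if its discriminant $\mathrm{Disc}_{A/K}=\det\big(\mathrm{Tr}_{A/K}(b_ib_j)\big)_{i,j}$ is invertible in $K$. The case $m=0$ (zero algebra) is allowed, the empty determinant being $1$, so the zero algebra is trace-étale. *)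

theory Defs
  imports
    "HOL-Library.Poly_Mapping"
    "HOL-Algebra.QuotRing"
    "Jordan_Normal_Form.Determinant"
    "Jordan_Normal_Form.VS_Connect"
begin

text \<open>
  The base field is a type \<open>'k :: field\<close>, seen as the record \<^term>\<open>class_ring\<close>.
  A \<open>'k\<close>-algebra is a record satisfying \<^term>\<open>algebra class_ring A\<close>; unlike a type of class
  \<open>comm_ring_1\<close>, it may be the zero algebra.
\<close>

section \<open>Finitely presented algebras\<close>

text \<open>Exponent vectors are finitely supported maps \<open>nat \<Rightarrow>\<^sub>0 nat\<close>; \<open>X\<^sub>1, \<dots>, X\<^sub>n\<close> have the indices
  \<open>0, \<dots>, n - 1\<close>.\<close>

type_synonym 'k mpol = "(nat \<Rightarrow>\<^sub>0 nat) \<Rightarrow>\<^sub>0 'k"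

definition mpol_ring :: "nat \<Rightarrow> ('k :: field) mpol ring" where
  "mpol_ring n =
    \<lparr>carrier = {p. \<forall>m \<in> Poly_Mapping.keys p. Poly_Mapping.keys m \<subseteq> {..<n}},
     mult = (*), one = 1, zero = 0, add = (+)\<rparr>"

definition mpol_const :: "'k :: field \<Rightarrow> 'k mpol" where
  "mpol_const c = Poly_Mapping.single 0 c"

definition mpol_pderiv :: "nat \<Rightarrow> ('k :: field) mpol \<Rightarrow> 'k mpol" where
  "mpol_pderiv j p =
    (\<Sum>m \<in> Poly_Mapping.keys p.
      Poly_Mapping.single (m - Poly_Mapping.single j 1)
        (of_nat (Poly_Mapping.lookup m j) * Poly_Mapping.lookup p m))"

definition rel_ideal :: "nat \<Rightarrow> ('k :: field) mpol list \<Rightarrow> 'k mpol set" where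
  "rel_ideal n fs = Idl\<^bsub>mpol_ring n\<^esub> (set fs)"

definition fp_algebra :: "nat \<Rightarrow> ('k :: field) mpol list \<Rightarrow> ('k, 'k mpol set) module" where
  "fp_algebra n fs =
    (let P = mpol_ring n; I = rel_ideal n fs; Q = P Quot I in
      \<lparr>carrier = carrier Q, mult = mult Q, one = one Q, zero = zero Q, add = add Q,
       smult = (\<lambda>c x. (I +>\<^bsub>P\<^esub> mpol_const c) \<otimes>\<^bsub>Q\<^esub> x)\<rparr>)"

definition algebra_iso :: "('k :: field, 'a) module \<Rightarrow> ('k, 'b) module \<Rightarrow> ('a \<Rightarrow> 'b) set" where
  "algebra_iso A B = ring_iso A B \<inter> LinearCombinations.module_hom class_ring A B"

definition presentation ::
  "('k :: field, 'a) module \<Rightarrow> nat \<Rightarrow> 'k mpol list \<Rightarrow> ('k mpol set \<Rightarrow> 'a) \<Rightarrow> bool" where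
  "presentation A n fs \<phi> \<longleftrightarrow>
    algebra class_ring A \<and> set fs \<subseteq> carrier (mpol_ring n) \<and> \<phi> \<in> algebra_iso (fp_algebra n fs) A"

text \<open>The value in \<open>A\<close> of a polynomial.\<close>

definition eval_in :: "nat \<Rightarrow> ('k :: field) mpol list \<Rightarrow> ('k mpol set \<Rightarrow> 'a) \<Rightarrow> 'k mpol \<Rightarrow> 'a" where
  "eval_in n fs \<phi> p = \<phi> (rel_ideal n fs +>\<^bsub>mpol_ring n\<^esub> p)"

section \<open>Differentials and net algebras\<close>

text \<open>The free module \<open>A\<^sup>m\<close> is \<^term>\<open>ring.func_space A {..<m}\<close>.\<close>

definition Ja :: "('k :: field, 'a) module \<Rightarrow> nat \<Rightarrow> 'k mpol list \<Rightarrow> ('k mpol set \<Rightarrow> 'a) \<Rightarrow>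
    (nat \<Rightarrow> 'a) \<Rightarrow> (nat \<Rightarrow> 'a)" where
  "Ja A n fs \<phi> u =
    (\<lambda>j \<in> {..<n}. \<Oplus>\<^bsub>A\<^esub> i \<in> {..<length fs}. eval_in n fs \<phi> (mpol_pderiv j (fs ! i)) \<otimes>\<^bsub>A\<^esub> u i)"

text \<open>The cokernel of \<open>h : M \<rightarrow> N\<close>. The ring structure that the record type of modules carries along
  is meaningless here.\<close>

definition coker :: "('r, 'a) module \<Rightarrow> ('r, 'b) module \<Rightarrow> ('a \<Rightarrow> 'b) \<Rightarrow> ('r, 'b set) module" where
  "coker M N h = (let H = h ` carrier M in
    \<lparr>carrier = a_rcosets\<^bsub>N\<^esub> H, mult = undefined, one = undefined, zero = H, add = set_add N,
     smult = (\<lambda>a C. \<Union>x \<in> C. H +>\<^bsub>N\<^esub> (a \<odot>\<^bsub>N\<^esub> x))\<rparr>)"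

definition Omega :: "('k :: field, 'a) module \<Rightarrow> nat \<Rightarrow> 'k mpol list \<Rightarrow> ('k mpol set \<Rightarrow> 'a) \<Rightarrow>
    ('a, (nat \<Rightarrow> 'a) set) module" where
  "Omega A n fs \<phi> =
    coker (ring.func_space A {..<length fs}) (ring.func_space A {..<n}) (Ja A n fs \<phi>)"

definition net :: "('k :: field, 'a) module \<Rightarrow> nat \<Rightarrow> 'k mpol list \<Rightarrow> ('k mpol set \<Rightarrow> 'a) \<Rightarrow> bool" where
  "net A n fs \<phi> \<longleftrightarrow> carrier (Omega A n fs \<phi>) = {\<zero>\<^bsub>Omega A n fs \<phi>\<^esub>}"

section \<open>Strictly finite and trace-etale algebras\<close>

definition finite_basis :: "('k :: field, 'a) module \<Rightarrow> 'a list \<Rightarrow> bool" where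
  "finite_basis A bs \<longleftrightarrow> distinct bs \<and> vectorspace.basis class_ring A (set bs)"

definition strictly_finite :: "('k :: field, 'a) module \<Rightarrow> bool" where
  "strictly_finite A \<longleftrightarrow> (\<exists>bs. finite_basis A bs)"

text \<open>The coordinates and the trace are meaningful when \<open>bs\<close> is a basis.\<close>

definition coords :: "('k :: field, 'a) module \<Rightarrow> 'a list \<Rightarrow> 'a \<Rightarrow> 'k vec" where
  "coords A bs x = (THE c. c \<in> carrier_vec (length bs) \<and>
    x = (\<Oplus>\<^bsub>A\<^esub> i \<in> {..<length bs}. (c $ i) \<odot>\<^bsub>A\<^esub> (bs ! i)))"

definition mult_mat :: "('k :: field, 'a) module \<Rightarrow> 'a list \<Rightarrow> 'a \<Rightarrow> 'k mat" where
  "mult_mat A bs a = mat (length bs) (length bs) (\<lambda>(i, j). coords A bs (a \<otimes>\<^bsub>A\<^esub> bs ! j) $ i)"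

definition alg_trace :: "('k :: field, 'a) module \<Rightarrow> 'a list \<Rightarrow> 'a \<Rightarrow> 'k" where
  "alg_trace A bs a = (\<Sum>i<length bs. mult_mat A bs a $$ (i, i))"

definition alg_disc :: "('k :: field, 'a) module \<Rightarrow> 'a list \<Rightarrow> 'k" where
  "alg_disc A bs =
    det (mat (length bs) (length bs) (\<lambda>(i, j). alg_trace A bs (bs ! i \<otimes>\<^bsub>A\<^esub> bs ! j)))"

definition trace_etale :: "('k :: field, 'a) module \<Rightarrow> bool" where
  "trace_etale A \<longleftrightarrow> (\<exists>bs. finite_basis A bs \<and> alg_disc A bs dvd 1)"

section \<open>Well-formedness of the definitions\<close>

lemma mpol_cring: "cring (mpol_ring n :: ('k::field) mpol ring)"
proof (rule cringI)
  show "abelian_group (mpol_ring n :: 'k mpol ring)"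
  proof (rule abelian_groupI)
    fix x y :: "'k mpol"
    assume "x \<in> carrier (mpol_ring n)" "y \<in> carrier (mpol_ring n)"
    then show "x \<oplus>\<^bsub>mpol_ring n\<^esub> y \<in> carrier (mpol_ring n)"
      using Poly_Mapping.keys_add[of x y] by (auto simp: mpol_ring_def)
  next
    fix x :: "'k mpol"
    assume "x \<in> carrier (mpol_ring n)"
    then show "\<exists>y\<in>carrier (mpol_ring n). y \<oplus>\<^bsub>mpol_ring n\<^esub> x = \<zero>\<^bsub>mpol_ring n\<^esub>"
      by (intro bexI[of _ "-x"]) (auto simp: mpol_ring_def)
  qed (auto simp: mpol_ring_def algebra_simps)
  show "comm_monoid (mpol_ring n :: 'k mpol ring)"
  proof (rule comm_monoidI)
    fix x y :: "'k mpol"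
    assume x: "x \<in> carrier (mpol_ring n)" "y \<in> carrier (mpol_ring n)"
    have "Poly_Mapping.keys m \<subseteq> {..<n}" if m: "m \<in> Poly_Mapping.keys (x*y)" for m
    proof -
      from m Poly_Mapping.keys_mult[of x y] obtain a b where "m = a + b" 
        "a \<in> Poly_Mapping.keys x" "b \<in> Poly_Mapping.keys y" by blast
      then show ?thesis using x Poly_Mapping.keys_add[of a b] unfolding mpol_ring_def by fastforce
    qed
    then show "x \<otimes>\<^bsub>mpol_ring n\<^esub> y \<in> carrier (mpol_ring n)"
      by (auto simp: mpol_ring_def)
  qed (auto simp: mpol_ring_def algebra_simps)
qed (auto simp: mpol_ring_def algebra_simps)

lemma rel_ideal_ideal: "set fs \<subseteq> carrier (mpol_ring n) \<Longrightarrow> ideal (rel_ideal n fs) (mpol_ring n)"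
  unfolding rel_ideal_def by (intro ring.genideal_ideal cring.axioms(1)[OF mpol_cring])

lemma fp_algebra_algebra:
  fixes fs :: "('k::field) mpol list"
  assumes fs: "set fs \<subseteq> carrier (mpol_ring n)"
  shows "algebra class_ring (fp_algebra n fs)"
proof -
  let ?P = "mpol_ring n :: 'k mpol ring" and ?I = "rel_ideal n fs"
  let ?Q = "?P Quot ?I" and ?A = "fp_algebra n fs"
  let ?s = "\<lambda>c. ?I +>\<^bsub>?P\<^esub> mpol_const c"
  interpret I: ideal ?I ?P using rel_ideal_ideal[OF fs] .
  interpret Q: cring ?Q by (rule I.quotient_is_cring[OF mpol_cring])
  have rh: "(+>\<^bsub>?P\<^esub>) ?I \<in> Ring.ring_hom ?P ?Q" by (rule I.rcos_ring_hom)
  have cc: "mpol_const c \<in> carrier ?P" for c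
    by (auto simp: mpol_ring_def mpol_const_def)
  have s: "?s c \<in> carrier ?Q" for c using ring_hom_closed[OF rh cc] .
  have sa: "?s (c + d) = ?s c \<oplus>\<^bsub>?Q\<^esub> ?s d" for c d
    using ring_hom_add[OF rh cc cc, of c d]
    by (simp add: mpol_const_def single_add mpol_ring_def)
  have sm: "?s (c * d) = ?s c \<otimes>\<^bsub>?Q\<^esub> ?s d" for c d
    using ring_hom_mult[OF rh cc cc, of c d]
    by (simp add: mpol_const_def mult_single mpol_ring_def)
  have s1: "?s 1 = \<one>\<^bsub>?Q\<^esub>"
    using ring_hom_one[OF rh] by (simp add: mpol_const_def mpol_ring_def)
  have A: "carrier ?A = carrier ?Q" "mult ?A = mult ?Q" "one ?A = one ?Q" "zero ?A = zero ?Q" "add ?A = add ?Q"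
    "smult ?A = (\<lambda>c x. ?s c \<otimes>\<^bsub>?Q\<^esub> x)" by (simp_all add: fp_algebra_def Let_def)
  have "cring ?A"
  proof (rule cringI)
    show "abelian_group ?A"
    proof (rule abelian_groupI)
      fix x
      assume "x \<in> carrier ?A"
      then show "\<exists>y\<in>carrier ?A. y \<oplus>\<^bsub>?A\<^esub> x = \<zero>\<^bsub>?A\<^esub>"
        by (intro bexI[of _ "\<ominus>\<^bsub>?Q\<^esub> x"]) (simp_all add: A Q.l_neg)
    qed (simp_all add: A Q.a_ac)
    show "comm_monoid ?A"
      by (rule comm_monoidI) (simp_all add: A Q.m_ac)
  qed (simp_all add: A Q.l_distr)
  then show ?thesis
    by (intro algebraI class_cring.cring_axioms)
       (simp_all add: A s sa sm s1 Q.l_distr Q.r_distr Q.m_assoc)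
qed

lemma presentation_self:
  fixes fs :: "('k::field) mpol list"
  assumes fs: "set fs \<subseteq> carrier (mpol_ring n)"
  shows "presentation (fp_algebra n fs) n fs id"
  unfolding presentation_def algebra_iso_def LinearCombinations.module_hom_def ring_iso_def
  using fp_algebra_algebra[OF fs] fs by (auto intro!: ring_hom_memI)

lemma pderiv_closed:
  fixes p :: "('k::field) mpol"
  assumes p: "p \<in> carrier (mpol_ring n)"
  shows "mpol_pderiv j p \<in> carrier (mpol_ring n)"
proof -
  let ?C = "carrier (mpol_ring n :: 'k mpol ring)"
  interpret cring "mpol_ring n :: 'k mpol ring" by (rule mpol_cring)
  have C0: "0 \<in> ?C"
    using zero_closed by (simp add: mpol_ring_def)
  have Cadd: "x + y \<in> ?C" if "x \<in> ?C" "y \<in> ?C" for x y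
    using add.m_closed[OF that] by (simp add: mpol_ring_def)
  have Csingle: "Poly_Mapping.single m c \<in> ?C" if "Poly_Mapping.keys m \<subseteq> {..<n}" for m c
    using that by (simp add: mpol_ring_def)
  have Csum: "sum f S \<in> ?C" if "finite S" "\<And>m. m \<in> S \<Longrightarrow> f m \<in> ?C" for f and S :: "(nat \<Rightarrow>\<^sub>0 nat) set"
    using that by (induction S rule: finite_induct) (simp_all add: C0 Cadd)
  have sub: "Poly_Mapping.keys (m - Poly_Mapping.single j 1) \<subseteq> {..<n}"
    if "m \<in> Poly_Mapping.keys p" for m
  proof -
    have "Poly_Mapping.keys (m - Poly_Mapping.single j 1) \<subseteq> Poly_Mapping.keys m"
      by (auto simp: in_keys_iff lookup_minus)
    also have "\<dots> \<subseteq> {..<n}" using p that by (simp add: mpol_ring_def)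
    finally show ?thesis .
  qed
  show ?thesis
    unfolding mpol_pderiv_def by (intro Csum Csingle sub) simp_all
qed

lemma eval_closed:
  assumes "presentation A n fs \<phi>" "p \<in> carrier (mpol_ring n)"
  shows "eval_in n fs \<phi> p \<in> carrier A"
proof -
  have fs: "set fs \<subseteq> carrier (mpol_ring n)" and ph: "\<phi> \<in> Ring.ring_hom (fp_algebra n fs) A"
    using assms unfolding presentation_def algebra_iso_def ring_iso_def by auto
  interpret I: ideal "rel_ideal n fs" "mpol_ring n" using rel_ideal_ideal[OF fs] .
  have "rel_ideal n fs +>\<^bsub>mpol_ring n\<^esub> p \<in> carrier (fp_algebra n fs)"
    using ring_hom_closed[OF I.rcos_ring_hom assms(2)] by (simp add: fp_algebra_def Let_def)
  then show ?thesis unfolding eval_in_def using ring_hom_closed[OF ph] by blast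
qed

lemma Ja_hom:
  assumes P: "presentation A n fs \<phi>"
  shows "mod_hom A (ring.func_space A {..<length fs}) (ring.func_space A {..<n}) (Ja A n fs \<phi>)"
proof -
  have "algebra class_ring A" using assms presentation_def by blast
  then interpret A: cring A by (simp add: algebra_def)
  have fs: "set fs \<subseteq> carrier (mpol_ring n)" using P unfolding presentation_def by auto
  define e where "e i j = eval_in n fs \<phi> (mpol_pderiv j (fs ! i))" for i j
  have e: "e i j \<in> carrier A" if "i < length fs" for i j
    unfolding e_def using that fs by (intro eval_closed[OF P] pderiv_closed) auto
  let ?S = "{..<length fs}"
  have Ja: "Ja A n fs \<phi> u = (\<lambda>j \<in> {..<n}. \<Oplus>\<^bsub>A\<^esub> i \<in> ?S. e i j \<otimes>\<^bsub>A\<^esub> u i)" for u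
    by (simp add: Ja_def e_def)
  have t: "e i j \<otimes>\<^bsub>A\<^esub> u i \<in> carrier A" if "i \<in> ?S" "u \<in> ?S \<rightarrow>\<^sub>E carrier A" for i j u
    using that e[of i j] by (intro A.m_closed) (auto simp: PiE_mem)
  have add: "(\<Oplus>\<^bsub>A\<^esub> i \<in> ?S. e i j \<otimes>\<^bsub>A\<^esub> (\<lambda>i\<in>?S. u i \<oplus>\<^bsub>A\<^esub> v i) i) =
      (\<Oplus>\<^bsub>A\<^esub> i \<in> ?S. e i j \<otimes>\<^bsub>A\<^esub> u i) \<oplus>\<^bsub>A\<^esub> (\<Oplus>\<^bsub>A\<^esub> i \<in> ?S. e i j \<otimes>\<^bsub>A\<^esub> v i)"
    if u: "u \<in> ?S \<rightarrow>\<^sub>E carrier A" and v: "v \<in> ?S \<rightarrow>\<^sub>E carrier A" for u v j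
  proof -
    have "(\<Oplus>\<^bsub>A\<^esub> i \<in> ?S. e i j \<otimes>\<^bsub>A\<^esub> (\<lambda>i\<in>?S. u i \<oplus>\<^bsub>A\<^esub> v i) i) =
        (\<Oplus>\<^bsub>A\<^esub> i \<in> ?S. e i j \<otimes>\<^bsub>A\<^esub> u i \<oplus>\<^bsub>A\<^esub> e i j \<otimes>\<^bsub>A\<^esub> v i)"
    proof (rule A.finsum_cong')
      fix i assume i: "i \<in> ?S"
      then show "e i j \<otimes>\<^bsub>A\<^esub> (\<lambda>i\<in>?S. u i \<oplus>\<^bsub>A\<^esub> v i) i =
          e i j \<otimes>\<^bsub>A\<^esub> u i \<oplus>\<^bsub>A\<^esub> e i j \<otimes>\<^bsub>A\<^esub> v i"
        using A.r_distr[OF PiE_mem[OF u i] PiE_mem[OF v i] e[of i j]] by simp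
    qed (use t u v in simp_all)
    also have "\<dots> = (\<Oplus>\<^bsub>A\<^esub> i \<in> ?S. e i j \<otimes>\<^bsub>A\<^esub> u i) \<oplus>\<^bsub>A\<^esub> (\<Oplus>\<^bsub>A\<^esub> i \<in> ?S. e i j \<otimes>\<^bsub>A\<^esub> v i)"
      by (rule A.finsum_addf) (use t u v in simp_all)
    finally show ?thesis .
  qed
  have smult: "(\<Oplus>\<^bsub>A\<^esub> i \<in> ?S. e i j \<otimes>\<^bsub>A\<^esub> (\<lambda>i\<in>?S. r \<otimes>\<^bsub>A\<^esub> u i) i) =
      r \<otimes>\<^bsub>A\<^esub> (\<Oplus>\<^bsub>A\<^esub> i \<in> ?S. e i j \<otimes>\<^bsub>A\<^esub> u i)"
    if r: "r \<in> carrier A" and u: "u \<in> ?S \<rightarrow>\<^sub>E carrier A" for r u j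
  proof -
    have "(\<Oplus>\<^bsub>A\<^esub> i \<in> ?S. e i j \<otimes>\<^bsub>A\<^esub> (\<lambda>i\<in>?S. r \<otimes>\<^bsub>A\<^esub> u i) i) =
        (\<Oplus>\<^bsub>A\<^esub> i \<in> ?S. r \<otimes>\<^bsub>A\<^esub> (e i j \<otimes>\<^bsub>A\<^esub> u i))"
    proof (rule A.finsum_cong')
      fix i assume i: "i \<in> ?S"
      then show "e i j \<otimes>\<^bsub>A\<^esub> (\<lambda>i\<in>?S. r \<otimes>\<^bsub>A\<^esub> u i) i = r \<otimes>\<^bsub>A\<^esub> (e i j \<otimes>\<^bsub>A\<^esub> u i)"
        using A.m_lcomm[OF e[of i j] r PiE_mem[OF u i]] by simp
    qed (use t r u in simp_all)
    also have "\<dots> = r \<otimes>\<^bsub>A\<^esub> (\<Oplus>\<^bsub>A\<^esub> i \<in> ?S. e i j \<otimes>\<^bsub>A\<^esub> u i)"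
      by (rule A.finsum_rdistr[symmetric]) (use t r u in simp_all)
    finally show ?thesis .
  qed
  have "(\<Oplus>\<^bsub>A\<^esub> i \<in> ?S. e i j \<otimes>\<^bsub>A\<^esub> u i) \<in> carrier A" if "u \<in> ?S \<rightarrow>\<^sub>E carrier A" for u j
    by (rule A.finsum_closed) (use t that in simp_all)
  then have "Ja A n fs \<phi> \<in>
      LinearCombinations.module_hom A (A.func_space ?S) (A.func_space {..<n})"
    unfolding LinearCombinations.module_hom_def Ja
    by (auto simp: A.func_space_def add[simplified] smult[simplified] intro!: restrict_ext)
  then show ?thesis
    by (intro mod_hom.intro A.func_space_is_module mod_hom_axioms.intro)
qed

lemma net_iff_Ja_surj:
  assumes "presentation A n fs \<phi>"
  shows "net A n fs \<phi> \<longleftrightarrow> Ja A n fs \<phi> ` ({..<length fs} \<rightarrow>\<^sub>E carrier A) = ({..<n} \<rightarrow>\<^sub>E carrier A)"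
proof -
  let ?N = "ring.func_space A {..<n}"
  have "algebra class_ring A" using assms presentation_def by blast
  then interpret A: cring A by (simp add: algebra_def)
  interpret J: mod_hom A "ring.func_space A {..<length fs}" ?N "Ja A n fs \<phi>" by (rule Ja_hom[OF assms])
  let ?H = "Ja A n fs \<phi> ` carrier (ring.func_space A {..<length fs})"
  have H: "?H \<subseteq> carrier ?N" by auto
  have "subgroup ?H (add_monoid ?N)"
  proof
    show "?H \<subseteq> carrier (add_monoid ?N)" using H by simp
    show "x \<otimes>\<^bsub>add_monoid ?N\<^esub> y \<in> ?H" if "x \<in> ?H" "y \<in> ?H" for x y
      using that J.im_is_submodule unfolding J.im_def submodule_def by auto
    show "\<one>\<^bsub>add_monoid ?N\<^esub> \<in> ?H" 
      using J.im_is_submodule unfolding J.im_def submodule_def by auto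
    show "inv\<^bsub>add_monoid ?N\<^esub> x \<in> ?H" if "x \<in> ?H" for x
    proof -
      from that obtain u where u: "u \<in> carrier (ring.func_space A {..<length fs})"
        and x: "x = Ja A n fs \<phi> u" by blast
      have "\<ominus>\<^bsub>?N\<^esub> x = Ja A n fs \<phi> (\<ominus>\<^bsub>ring.func_space A {..<length fs}\<^esub> u)"
        unfolding x by (rule J.f_neg[OF u, symmetric])
      then show ?thesis 
        using abelian_group.a_inv_closed[OF module.axioms(2)[OF A.func_space_is_module] u]
        by (simp add: a_inv_def)
    qed
  qed
  moreover have N: "abelian_group ?N"
    by (rule module.axioms(2)[OF A.func_space_is_module])
  ultimately interpret H: abelian_subgroup ?H ?N
    by (intro abelian_subgroupI3 additive_subgroup.intro)
  have "net A n fs \<phi> \<longleftrightarrow> a_rcosets\<^bsub>?N\<^esub> ?H = {?H}"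
    by (simp add: net_def Omega_def coker_def Let_def)
  also have "\<dots> \<longleftrightarrow> ?H = carrier ?N"
  proof
    assume "a_rcosets\<^bsub>?N\<^esub> ?H = {?H}"
    then show "?H = carrier ?N" using H.a_rcosets_part_G by simp
  next
    assume e: "?H = carrier ?N"
    have "?H +>\<^bsub>?N\<^esub> x = ?H" if "x \<in> carrier ?N" for x
      using that e H.a_rcos_const by simp
    moreover have "\<zero>\<^bsub>?N\<^esub> \<in> carrier ?N"
      by (rule abelian_monoid.zero_closed[OF abelian_group.axioms(1)[OF N]])
    ultimately show "a_rcosets\<^bsub>?N\<^esub> ?H = {?H}"
      unfolding A_RCOSETS_def' by blast
  qed
  finally show ?thesis by (simp add: A.func_space_def)
qed

end

(*
  Write A = K[X]/I. By divided differences each relation f satisfies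
  f(X) - f(Y) = \<Sum>\<^sub>j D\<^sub>j f (X\<^sub>j - Y\<^sub>j) in K[X][Y], where D\<^sub>j f restricts to \<partial>f/\<partial>X\<^sub>j on the diagonal. A right inverse
  of Ja therefore yields a square matrix over A \<otimes> A that kills the vector of the X\<^sub>j - Y\<^sub>j and is the
  identity on the diagonal; its determinant is an element e = \<Sum> x\<^sub>s \<otimes> y\<^sub>s with (a \<otimes> 1) e = (1 \<otimes> a) e
  and \<Sum> x\<^sub>s y\<^sub>s = 1. Then a \<cdot> \<Sum> x\<^sub>s g(y\<^sub>s) = \<Sum> x\<^sub>s g(a y\<^sub>s) for every linear form g on A. Letting g run over
  the coordinates of a (possibly infinite) basis shows that A is finite-dimensional (Villamayor and
  Zelinsky); summing over a finite basis gives \<Sum> x\<^sub>s Tr(y\<^sub>s) = 1, hence a = \<Sum> x\<^sub>s Tr(a y\<^sub>s), so that the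
  trace form is nondegenerate.

  Conversely, if (b'\<^sub>i) is the basis dual to (b\<^sub>i) for the trace form, then \<Sum> b\<^sub>i b'\<^sub>i = 1 and
  \<Sum> a b\<^sub>i d(b'\<^sub>i) = \<Sum> b\<^sub>i d(a b'\<^sub>i) for every K-linear d; for a derivation d this gives d a = 0. Apply this
  to the universal derivation.
*)
theory Submission
  imports Defs
begin

section \<open>Quotients of commutative algebras\<close>

text \<open>The quotient of \<open>'r\<close> by \<open>I\<close> is never formed as a type; every
  statement about it is made on representatives modulo \<open>I\<close>. As \<open>I\<close> may be
  the whole ring, the zero algebra is covered.\<close>

locale quotient_algebra = vector_space scale
  for scale :: "'k :: field \<Rightarrow> 'r :: comm_ring_1 \<Rightarrow> 'r" +
  fixes I :: "'r set"
  assumes scale_mult: "scale c (x * y) = scale c x * y"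
    and I_zero: "0 \<in> I"
    and I_add: "x \<in> I \<Longrightarrow> y \<in> I \<Longrightarrow> x + y \<in> I"
    and I_mult: "x \<in> I \<Longrightarrow> r * x \<in> I"
begin

lemma scale_eq_mult: "scale c x = scale c 1 * x"
  using scale_mult[of c 1 x] by simp

lemma mult_scale: "x * scale c y = scale c (x * y)"
  using scale_mult[of c y x] by (simp add: mult.commute)

lemma I_minus: "x \<in> I \<Longrightarrow> - x \<in> I"
  using I_mult[of x "- 1"] by simp

lemma I_diff: "x \<in> I \<Longrightarrow> y \<in> I \<Longrightarrow> x - y \<in> I"
  using I_add[of x "- y"] I_minus by simp

lemma I_scale: "x \<in> I \<Longrightarrow> scale c x \<in> I"
  using scale_eq_mult I_mult by metis

lemma I_sum: "(\<And>s. s \<in> S \<Longrightarrow> f s \<in> I) \<Longrightarrow> sum f S \<in> I"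
  by (induction S rule: infinite_finite_induct) (auto simp: I_zero I_add)

section \<open>Congruence modulo \<open>I\<close>\<close>

definition cong :: "'r \<Rightarrow> 'r \<Rightarrow> bool" (infix "\<sim>" 50) where
  "x \<sim> y \<longleftrightarrow> x - y \<in> I"

lemma cong_refl [simp]: "x \<sim> x"
  by (simp add: cong_def I_zero)

lemma cong_sym: "x \<sim> y \<Longrightarrow> y \<sim> x"
  using I_minus[of "x - y"] by (simp add: cong_def)

lemma cong_trans [trans]: "x \<sim> y \<Longrightarrow> y \<sim> z \<Longrightarrow> x \<sim> z"
  using I_add[of "x - y" "y - z"] by (simp add: cong_def)

lemma cong_add: "x \<sim> y \<Longrightarrow> x' \<sim> y' \<Longrightarrow> x + x' \<sim> y + y'"
  using I_add[of "x - y" "x' - y'"] by (simp add: cong_def algebra_simps)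

lemma cong_mult_left: "x \<sim> y \<Longrightarrow> r * x \<sim> r * y"
  using I_mult[of "x - y" r] by (simp add: cong_def algebra_simps)

lemma cong_mult_right: "x \<sim> y \<Longrightarrow> x * r \<sim> y * r"
  using cong_mult_left[of x y r] by (simp add: mult.commute)

lemma cong_mult: "x \<sim> y \<Longrightarrow> x' \<sim> y' \<Longrightarrow> x * x' \<sim> y * y'"
  by (meson cong_mult_left cong_mult_right cong_trans)

lemma cong_sum: "(\<And>s. s \<in> S \<Longrightarrow> f s \<sim> h s) \<Longrightarrow> sum f S \<sim> sum h S"
  by (induction S rule: infinite_finite_induct) (auto simp: cong_add)

lemma cong_prod: "(\<And>s. s \<in> S \<Longrightarrow> f s \<sim> h s) \<Longrightarrow> prod f S \<sim> prod h S"
  by (induction S rule: infinite_finite_induct) (auto simp: cong_mult)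

text \<open>The determinant is an integer polynomial in the entries, by the Leibniz formula.\<close>

lemma cong_det:
  assumes "M \<in> carrier_mat n n" "M' \<in> carrier_mat n n"
    and "\<And>i j. i < n \<Longrightarrow> j < n \<Longrightarrow> M $$ (i, j) \<sim> M' $$ (i, j)"
  shows "det M \<sim> det M'"
  unfolding det_def'[OF assms(1)] det_def'[OF assms(2)]
  by (intro cong_sum cong_mult_left cong_prod assms(3))
    (auto dest: permutes_in_image)

section \<open>Linear forms on the quotient and its finite bases\<close>

definition dual :: "('r \<Rightarrow> 'k) set" where
  "dual = {g. (\<forall>x y. g (x + y) = g x + g y) \<and> (\<forall>c x. g (scale c x) = c * g x) \<and> (\<forall>x\<in>I. g x = 0)}"

context
  fixes g
  assumes g: "g \<in> dual"
begin

lemma dual_add: "g (x + y) = g x + g y"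
  and dual_scale: "g (scale c x) = c * g x"
  and dual_I: "x \<in> I \<Longrightarrow> g x = 0"
  using g by (auto simp: dual_def)

lemma dual_zero: "g 0 = 0"
  using dual_I I_zero by blast

lemma dual_diff: "g (x - y) = g x - g y"
  using dual_add[of "x - y" y] by simp

lemma dual_cong: "x \<sim> y \<Longrightarrow> g x = g y"
  using dual_I[of "x - y"] dual_diff[of x y] by (simp add: cong_def)

lemma dual_sum: "g (sum f S) = (\<Sum>s\<in>S. g (f s))"
  by (induction S rule: infinite_finite_induct) (auto simp: dual_zero dual_add)

lemma dual_mult: "(\<lambda>x. g (a * x)) \<in> dual"
  using g by (simp add: dual_def distrib_left mult_scale I_mult)

end

lemma dual_sumI: "(\<And>s. s \<in> S \<Longrightarrow> f s \<in> dual) \<Longrightarrow> (\<lambda>x. \<Sum>s\<in>S. f s x) \<in> dual"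
  by (simp add: dual_def sum.distrib sum_distrib_left)

text \<open>A basis of the quotient together with its coordinate forms: the delta condition gives
  independence modulo \<open>I\<close>, the last condition gives generation. If \<open>I\<close> is
  the whole ring, then \<open>m = 0\<close> is forced.\<close>

definition quotient_basis :: "nat \<Rightarrow> (nat \<Rightarrow> 'r) \<Rightarrow> (nat \<Rightarrow> 'r \<Rightarrow> 'k) \<Rightarrow> bool" where
  "quotient_basis m b g \<longleftrightarrow>
    (\<forall>i<m. g i \<in> dual) \<and> (\<forall>i<m. \<forall>j<m. g i (b j) = (if i = j then 1 else 0)) \<and>
    (\<forall>x. x \<sim> (\<Sum>i<m. scale (g i x) (b i)))"

context
  fixes B0 B
  assumes B0: "B0 \<subseteq> I" "independent B0" "I \<subseteq> span B0"
    and B: "B0 \<subseteq> B" "independent B" "UNIV \<subseteq> span B"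
begin

text \<open>Elements of \<open>I\<close> are already combinations of \<open>B0\<close>, so their
  coordinates outside \<open>B0\<close> vanish.\<close>

lemma representation_dual:
  assumes "v \<notin> B0"
  shows "(\<lambda>x. representation B x v) \<in> dual"
proof -
  have B_UNIV: "x \<in> span B" for x using B(3) by blast
  have "representation B x v = 0" if "x \<in> I" for x
  proof -
    have "representation B x = representation B0 x"
      using that B0(3) by (intro representation_extend B B0) auto
    then show ?thesis
      using \<open>v \<notin> B0\<close> representation_ne_zero by auto
  qed
  then show ?thesis
    using B(2) B_UNIV by (auto simp: dual_def representation_add representation_scale)
qed

lemma representation_cong:
  assumes F: "finite F" "F \<inter> B0 = {}" "{v. representation B x v \<noteq> 0} \<subseteq> F \<union> B0"
  shows "x \<sim> (\<Sum>v\<in>F. scale (representation B x v) v)"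
proof -
  let ?r = "representation B x"
  let ?S = "{v. ?r v \<noteq> 0}"
  have fin: "finite ?S" by (rule finite_representation)
  have "x \<in> span B" using B(3) by blast
  then have "x = (\<Sum>v\<in>?S. scale (?r v) v)"
    using sum_nonzero_representation_eq[OF B(2), of x] by simp
  also have "\<dots> = (\<Sum>v\<in>?S \<inter> B0. scale (?r v) v) + (\<Sum>v\<in>?S - B0. scale (?r v) v)"
    using fin by (subst sum.Int_Diff[where B = B0]) auto
  also have "(\<Sum>v\<in>?S - B0. scale (?r v) v) = (\<Sum>v\<in>F. scale (?r v) v)"
    using F by (intro sum.mono_neutral_left) auto
  finally have "x - (\<Sum>v\<in>F. scale (?r v) v) = (\<Sum>v\<in>?S \<inter> B0. scale (?r v) v)"
    by (simp add: algebra_simps)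
  moreover have "(\<Sum>v\<in>?S \<inter> B0. scale (?r v) v) \<in> I"
    using B0(1) by (intro I_sum I_scale) auto
  ultimately show ?thesis by (simp add: cong_def)
qed

end

text \<open>A basis of \<open>I\<close> is extended to one of the ring; the added vectors represent
  a basis of the quotient, and their coordinate functions are the forms \<open>g\<close>.\<close>

lemma quotient_basis_exists:
  assumes S: "finite S" "UNIV \<subseteq> span (I \<union> S)"
  shows "\<exists>m b g. quotient_basis m b g"
proof -
  obtain B0 where B0: "B0 \<subseteq> I" "independent B0" "I \<subseteq> span B0"
    using maximal_independent_subset by blast
  have "B0 \<subseteq> B0 \<union> S" by blast
  \<comment> \<open>Taking the new vectors from \<open>S\<close> only is what makes
    \<open>B - B0\<close> finite.\<close>
  then obtain B where B: "B0 \<subseteq> B" "B \<subseteq> B0 \<union> S" "independent B" "B0 \<union> S \<subseteq> span B"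
    using maximal_independent_subset_extend[of B0 "B0 \<union> S"] B0(2) by blast
  have "span B0 \<subseteq> span B"
    using B(1) by (rule span_mono)
  then have "I \<union> S \<subseteq> span B"
    using B0(3) B(4) by blast
  then have "span (I \<union> S) \<subseteq> span B"
    by (simp add: span_minimal)
  then have B_UNIV: "UNIV \<subseteq> span B"
    using S(2) by blast
  note B' = B0 B(1,3) B_UNIV
  have fin: "finite (B - B0)"
    using B(2) S(1) by (auto intro: finite_subset)
  then obtain m and b :: "nat \<Rightarrow> 'r" where b: "bij_betw b {..<m} (B - B0)"
    using ex_bij_betw_nat_finite[of "B - B0"] by (auto simp: atLeast0LessThan)
  define g where "g i x = representation B x (b i)" for i x
  have b_in: "b i \<in> B" "b i \<notin> B0" if "i < m" for i
    using bij_betw_apply[OF b, of i] that by auto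
  have "g i \<in> dual" if "i < m" for i
    unfolding g_def[abs_def] by (rule representation_dual[OF B' b_in(2)[OF that]])
  moreover have "g i (b j) = (if i = j then 1 else 0)" if "i < m" "j < m" for i j
    using that bij_betw_imp_inj_on[OF b] B(3) b_in
    by (auto simp: g_def representation_basis inj_on_eq_iff)
  moreover have "x \<sim> (\<Sum>i<m. scale (g i x) (b i))" for x
  proof -
    have "x \<sim> (\<Sum>v\<in>B - B0. scale (representation B x v) v)"
      using representation_ne_zero by (intro representation_cong[OF B'] fin) auto
    also have "\<dots> = (\<Sum>i<m. scale (g i x) (b i))"
      unfolding g_def by (rule sum.reindex_bij_betw[OF b, symmetric])
    finally show ?thesis .
  qed
  ultimately have "quotient_basis m b g"
    unfolding quotient_basis_def by (intro conjI allI impI)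
  then show ?thesis by (intro exI)
qed

section \<open>Trace form and discriminant\<close>

text \<open>\<open>g i (x * b i)\<close> is the i-th diagonal entry of the matrix of multiplication
  by \<open>x\<close> on the quotient, so the sum is its trace.\<close>

definition trace_form :: "nat \<Rightarrow> (nat \<Rightarrow> 'r) \<Rightarrow> (nat \<Rightarrow> 'r \<Rightarrow> 'k) \<Rightarrow> 'r \<Rightarrow> 'k" where
  "trace_form m b g x = (\<Sum>i<m. g i (x * b i))"

definition disc :: "nat \<Rightarrow> (nat \<Rightarrow> 'r) \<Rightarrow> (nat \<Rightarrow> 'r \<Rightarrow> 'k) \<Rightarrow> 'k" where
  "disc m b g = det (mat m m (\<lambda>(i, j). trace_form m b g (b i * b j)))"

context
  fixes m b g
  assumes qb: "quotient_basis m b g"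
begin

lemma qb_dual: "i < m \<Longrightarrow> g i \<in> dual"
  and qb_delta: "i < m \<Longrightarrow> j < m \<Longrightarrow> g i (b j) = (if i = j then 1 else 0)"
  and qb_expand: "x \<sim> (\<Sum>i<m. scale (g i x) (b i))"
  using qb by (auto simp: quotient_basis_def)

lemma trace_form_dual: "trace_form m b g \<in> dual"
proof -
  have "(\<lambda>x. g i (x * b i)) \<in> dual" if "i < m" for i
    using dual_mult[OF qb_dual[OF that], of "b i"] by (simp add: mult.commute)
  then show ?thesis
    unfolding trace_form_def[abs_def] by (intro dual_sumI) auto
qed

text \<open>A kernel vector of the Gram matrix is the coordinate vector of an element orthogonal to
  everything. That element lies in \<open>I\<close>, so its coordinates vanish.\<close>

lemma disc_nonzero_if_nondegenerate:
  assumes nd: "\<And>a. (\<And>x. trace_form m b g (a * x) = 0) \<Longrightarrow> a \<in> I"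
  shows "disc m b g \<noteq> 0"
proof
  let ?\<tau> = "trace_form m b g"
  let ?G = "mat m m (\<lambda>(i, j). ?\<tau> (b i * b j))"
  assume "disc m b g = 0"
  then obtain v where v: "v \<in> carrier_vec m" "v \<noteq> 0\<^sub>v m" "?G *\<^sub>v v = 0\<^sub>v m"
    using det_0_iff_vec_prod_zero_field[of ?G m] by (auto simp: disc_def)
  define a where "a = (\<Sum>j<m. scale (v $ j) (b j))"
  have ab: "?\<tau> (a * b i) = 0" if i: "i < m" for i
  proof -
    have "?\<tau> (a * b i) = ?\<tau> (\<Sum>j<m. scale (v $ j) (b i * b j))"
      by (simp add: a_def sum_distrib_left mult_scale mult.commute[of _ "b i"])
    also have "\<dots> = (\<Sum>j<m. ?\<tau> (b i * b j) * v $ j)"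
      by (simp add: dual_sum[OF trace_form_dual] dual_scale[OF trace_form_dual] mult.commute)
    also have "\<dots> = (?G *\<^sub>v v) $ i"
      using i v(1) by (simp add: scalar_prod_def atLeast0LessThan)
    also have "\<dots> = 0" using i v(3) by simp
    finally show ?thesis .
  qed
  have "?\<tau> (a * x) = 0" for x
  proof -
    have "?\<tau> (a * x) = ?\<tau> (a * (\<Sum>i<m. scale (g i x) (b i)))"
      by (intro dual_cong[OF trace_form_dual] cong_mult_left qb_expand)
    also have "\<dots> = 0"
      by (simp add: sum_distrib_left mult_scale dual_sum[OF trace_form_dual]
          dual_scale[OF trace_form_dual] ab)
    finally show ?thesis .
  qed
  then have "a \<in> I" by (rule nd)
  have "v $ i = 0" if i: "i < m" for i
  proof -
    have "0 = g i a" using dual_I[OF qb_dual[OF i] \<open>a \<in> I\<close>] by simp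
    also have "\<dots> = (\<Sum>j<m. if i = j then v $ j else 0)"
      unfolding a_def dual_sum[OF qb_dual[OF i]] dual_scale[OF qb_dual[OF i]]
      by (intro sum.cong) (simp_all add: qb_delta[OF i])
    also have "\<dots> = v $ i" using i by simp
    finally show ?thesis by simp
  qed
  then show False using v(1,2) by (auto intro!: eq_vecI)
qed

end

section \<open>Separability gives a finite basis and a nonzero discriminant\<close>

text \<open>The element \<open>\<Sum> e\<^sub>s \<otimes> y\<^sub>s\<close> below is a separability idempotent of the quotient by \<open>I\<close>; applying
  linear forms to its right factors avoids the tensor product.\<close>

lemma separable_imp_disc_nonzero:
  assumes S: "finite S" and one: "(\<Sum>s\<in>S. e s * y s) \<sim> 1"
    and sep: "\<And>g a. g \<in> dual \<Longrightarrow>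
      a * (\<Sum>s\<in>S. scale (g (y s)) (e s)) \<sim> (\<Sum>s\<in>S. scale (g (a * y s)) (e s))"
  shows "\<exists>m b g. quotient_basis m b g \<and> disc m b g \<noteq> 0"
proof -
  obtain B0 where B0: "B0 \<subseteq> I" "independent B0" "I \<subseteq> span B0"
    using maximal_independent_subset by blast
  obtain B where B: "B0 \<subseteq> B" "independent B" "UNIV \<subseteq> span B"
    by (rule maximal_independent_subset_extend[OF subset_UNIV B0(2)])
  define r where "r v x = representation B x v" for v x
  have r_dual: "r v \<in> dual" if "v \<notin> B0" for v
    unfolding r_def[abs_def] by (rule representation_dual[OF B0 B that])
  \<comment> \<open>Only finitely many vectors of \<open>B\<close> occur in the finitely many
    \<open>y s\<close>. This set does not depend on the element \<open>a\<close> expanded below,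
    which is why finitely many generators suffice.\<close>
  define F where "F = (\<Union>s\<in>S. {v. r v (y s) \<noteq> 0})"
  have fin: "finite F"
    unfolding F_def r_def using S finite_representation by blast
  have y: "y s \<sim> (\<Sum>v\<in>F - B0. scale (r v (y s)) v)" if s: "s \<in> S" for s
    unfolding r_def using fin s by (intro representation_cong[OF B0 B]) (auto simp: F_def r_def)
  \<comment> \<open>In \<open>a \<sim> a * (\<Sum>s\<in>S. e s * y s)\<close>, expand each
    \<open>y s\<close> over \<open>F - B0\<close> and let \<open>sep\<close> move \<open>a\<close>
    inside the coordinate forms: what is left are scalar multiples of the products
    \<open>e s * v\<close>.\<close>
  let ?S = "(\<lambda>(v, s). e s * v) ` ((F - B0) \<times> S)"
  have "a \<in> span (I \<union> ?S)" for a
  proof -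
    have "a * 1 \<sim> a * (\<Sum>s\<in>S. e s * y s)"
      by (intro cong_mult_left cong_sym[OF one])
    also have "\<dots> \<sim> a * (\<Sum>s\<in>S. e s * (\<Sum>v\<in>F - B0. scale (r v (y s)) v))"
      by (intro cong_mult_left cong_sum y)
    also have "\<dots> = (\<Sum>s\<in>S. \<Sum>v\<in>F - B0. v * (a * scale (r v (y s)) (e s)))"
      by (simp add: sum_distrib_left mult_scale mult_ac)
    also have "\<dots> = (\<Sum>v\<in>F - B0. v * (a * (\<Sum>s\<in>S. scale (r v (y s)) (e s))))"
      by (subst sum.swap) (simp add: sum_distrib_left)
    also have "\<dots> \<sim> (\<Sum>v\<in>F - B0. v * (\<Sum>s\<in>S. scale (r v (a * y s)) (e s)))"
      by (intro cong_sum cong_mult_left sep r_dual) auto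
    also have "\<dots> = (\<Sum>v\<in>F - B0. \<Sum>s\<in>S. scale (r v (a * y s)) (e s * v))"
      by (simp add: sum_distrib_left mult_scale mult_ac)
    finally have "a - (\<Sum>v\<in>F - B0. \<Sum>s\<in>S. scale (r v (a * y s)) (e s * v)) \<in> I"
      by (simp add: cong_def)
    then have "a - (\<Sum>v\<in>F - B0. \<Sum>s\<in>S. scale (r v (a * y s)) (e s * v)) \<in> span (I \<union> ?S)"
      by (intro span_base) blast
    moreover have "(\<Sum>v\<in>F - B0. \<Sum>s\<in>S. scale (r v (a * y s)) (e s * v)) \<in> span (I \<union> ?S)"
      by (intro span_sum span_scale span_base) force
    ultimately show ?thesis
      using span_add by fastforce
  qed
  moreover have "finite ?S"
    using fin S by simp
  ultimately obtain m b g where qb: "quotient_basis m b g"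
    using quotient_basis_exists[of ?S] by (auto simp: subset_iff)
  let ?\<tau> = "trace_form m b g"
  note \<tau> = trace_form_dual[OF qb]
  \<comment> \<open>Apply \<open>sep\<close> with \<open>a = b i\<close> and \<open>g = g i\<close>
    and sum over \<open>i\<close>; the coordinates of \<open>y s\<close> then reassemble to
    \<open>y s\<close>.\<close>
  have trace_one: "(\<Sum>s\<in>S. scale (?\<tau> (y s)) (e s)) \<sim> 1"
  proof -
    have "(\<Sum>s\<in>S. scale (?\<tau> (y s)) (e s)) = (\<Sum>i<m. \<Sum>s\<in>S. scale (g i (b i * y s)) (e s))"
      unfolding trace_form_def scale_sum_left by (subst sum.swap) (simp add: mult.commute)
    also have "\<dots> \<sim> (\<Sum>i<m. b i * (\<Sum>s\<in>S. scale (g i (y s)) (e s)))"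
      by (intro cong_sum cong_sym[OF sep] qb_dual[OF qb]) auto
    also have "\<dots> = (\<Sum>s\<in>S. e s * (\<Sum>i<m. scale (g i (y s)) (b i)))"
      unfolding sum_distrib_left by (subst sum.swap) (simp add: mult_scale mult_ac)
    also have "\<dots> \<sim> (\<Sum>s\<in>S. e s * y s)"
      by (intro cong_sum cong_mult_left cong_sym[OF qb_expand[OF qb]])
    also note one
    finally show ?thesis .
  qed
  have "a \<in> I" if a: "\<And>x. ?\<tau> (a * x) = 0" for a
  proof -
    have "a * 1 \<sim> a * (\<Sum>s\<in>S. scale (?\<tau> (y s)) (e s))"
      by (intro cong_mult_left cong_sym[OF trace_one])
    also have "\<dots> \<sim> (\<Sum>s\<in>S. scale (?\<tau> (a * y s)) (e s))"
      by (rule sep[OF \<tau>])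
    finally show ?thesis by (simp add: a cong_def)
  qed
  then have "disc m b g \<noteq> 0"
    by (intro disc_nonzero_if_nondegenerate[OF qb]) blast
  with qb show ?thesis by (intro exI conjI)
qed


section \<open>Derivations when the discriminant is nonzero\<close>

context
  fixes m b g
  assumes qb: "quotient_basis m b g" and disc: "disc m b g \<noteq> 0"
begin

private abbreviation "\<tau> \<equiv> trace_form m b g"

private lemmas \<tau> = trace_form_dual[OF qb]

text \<open>The coordinates of \<open>b' j\<close> are column \<open>j\<close> of the inverse Gram
  matrix, written as the adjugate divided by the discriminant.\<close>

lemma trace_dual_basis:
  obtains b' where "\<And>i j. i < m \<Longrightarrow> j < m \<Longrightarrow> \<tau> (b i * b' j) = (if i = j then 1 else 0)"
proof -
  let ?G = "mat m m (\<lambda>(i, j). \<tau> (b i * b j))"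
  let ?H = "adj_mat ?G"
  let ?D = "disc m b g"
  have G: "?G \<in> carrier_mat m m" by simp
  note H = adj_mat[OF G]
  define b' where "b' j = (\<Sum>k<m. scale (?H $$ (k, j) / ?D) (b k))" for j
  have "\<tau> (b i * b' j) = (if i = j then 1 else 0)" if ij: "i < m" "j < m" for i j
  proof -
    have "\<tau> (b i * b' j) = (\<Sum>k<m. ?H $$ (k, j) / ?D * \<tau> (b i * b k))"
      by (simp add: b'_def sum_distrib_left mult_scale dual_sum[OF \<tau>] dual_scale[OF \<tau>])
    also have "\<dots> = (\<Sum>k<m. ?G $$ (i, k) * ?H $$ (k, j)) / ?D"
      using ij by (simp add: sum_divide_distrib mult.commute)
    also have "(\<Sum>k<m. ?G $$ (i, k) * ?H $$ (k, j)) = (?G * ?H) $$ (i, j)"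
      using ij H(1) by (simp add: times_mat_def scalar_prod_def atLeast0LessThan)
    also have "\<dots> = (if i = j then ?D else 0)"
      using ij by (simp add: H(2) disc_def)
    finally show ?thesis using disc by simp
  qed
  then show ?thesis by (rule that)
qed

text \<open>Functions into \<open>'r\<close> modulo \<open>N\<close> form a module over the quotient
  by \<open>I\<close> (\<open>N_I\<close>), and \<open>d\<close> induces a derivation of the
  quotient into it (\<open>d_I\<close>). The conclusion is that this derivation is zero; using
  representatives avoids forming the module.\<close>

lemma derivation_mem_of_disc_nonzero:
  fixes d :: "'r \<Rightarrow> 'j \<Rightarrow> 'r" and N :: "('j \<Rightarrow> 'r) set"
  assumes d_add: "\<And>x y. d (x + y) = (\<lambda>j. d x j + d y j)"
    and d_mult: "\<And>x y. d (x * y) = (\<lambda>j. x * d y j + y * d x j)"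
    and d_scale: "\<And>c x. d (scale c x) = (\<lambda>j. scale c (d x j))"
    and d_I: "\<And>x. x \<in> I \<Longrightarrow> d x \<in> N"
    and N_add: "\<And>v w. v \<in> N \<Longrightarrow> w \<in> N \<Longrightarrow> (\<lambda>j. v j + w j) \<in> N"
    and N_mult: "\<And>r v. v \<in> N \<Longrightarrow> (\<lambda>j. r * v j) \<in> N"
    and N_I: "\<And>v. (\<And>j. v j \<in> I) \<Longrightarrow> v \<in> N"
  shows "d a \<in> N"
proof -
  obtain b' where b': "\<And>i j. i < m \<Longrightarrow> j < m \<Longrightarrow> \<tau> (b i * b' j) = (if i = j then 1 else 0)"
    using trace_dual_basis by blast
  \<comment> \<open>Duality turns each coordinate form into a trace against \<open>b' i\<close>, so
    the trace form is nondegenerate and \<open>b\<close> and \<open>b'\<close> can both be used for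
    expansions.\<close>
  have coord: "g i y = \<tau> (y * b' i)" if i: "i < m" for i y
  proof -
    have "\<tau> (y * b' i) = \<tau> ((\<Sum>j<m. scale (g j y) (b j)) * b' i)"
      by (intro dual_cong[OF \<tau>] cong_mult_right qb_expand[OF qb])
    also have "\<dots> = (\<Sum>j<m. g j y * \<tau> (b j * b' i))"
      by (simp add: sum_distrib_right scale_mult[symmetric] dual_sum[OF \<tau>] dual_scale[OF \<tau>])
    also have "\<dots> = (\<Sum>j<m. if i = j then g j y else 0)"
      by (intro sum.cong) (simp_all add: b' i)
    finally show ?thesis using i by simp
  qed
  have nd: "z \<in> I" if "\<And>x. \<tau> (z * x) = 0" for z
    using qb_expand[OF qb, of z] that by (simp add: coord cong_def)
  have nd_basis: "z \<in> I" if z: "\<And>j. j < m \<Longrightarrow> \<tau> (z * b j) = 0" for z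
  proof (rule nd)
    fix x
    have "\<tau> (z * x) = \<tau> (z * (\<Sum>j<m. scale (g j x) (b j)))"
      by (intro dual_cong[OF \<tau>] cong_mult_left qb_expand[OF qb])
    also have "\<dots> = 0"
      by (simp add: sum_distrib_left mult_scale dual_sum[OF \<tau>] dual_scale[OF \<tau>] z)
    finally show "\<tau> (z * x) = 0" .
  qed
  have expand: "y - (\<Sum>j<m. scale (\<tau> (y * b' j)) (b j)) \<in> I" for y
    using qb_expand[OF qb, of y] by (simp add: coord cong_def)
  have expand': "y - (\<Sum>i<m. scale (\<tau> (y * b i)) (b' i)) \<in> I" for y
  proof (rule nd_basis)
    fix j assume j: "j < m"
    have "\<tau> ((\<Sum>i<m. scale (\<tau> (y * b i)) (b' i)) * b j) = (\<Sum>i<m. \<tau> (y * b i) * \<tau> (b j * b' i))"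
      by (simp add: sum_distrib_right scale_mult[symmetric] dual_sum[OF \<tau>] dual_scale[OF \<tau>]
          mult.commute[of "b j"])
    also have "\<dots> = (\<Sum>i<m. if j = i then \<tau> (y * b i) else 0)"
      by (intro sum.cong) (simp_all add: b' j)
    also have "\<dots> = \<tau> (y * b j)" using j by simp
    finally show "\<tau> ((y - (\<Sum>i<m. scale (\<tau> (y * b i)) (b' i))) * b j) = 0"
      by (simp add: left_diff_distrib dual_diff[OF \<tau>])
  qed
  \<comment> \<open>\<open>c\<close> is the image of \<Sum> b_i \<otimes> b'_i under multiplication.
    It is 1 modulo \<open>I\<close>, because the trace of \<open>c * x\<close> is the sum of the
    coordinates \<open>g i (x * b i)\<close>, which is the trace of \<open>x\<close>.\<close>
  define c where "c = (\<Sum>i<m. b i * b' i)"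
  have c: "c - 1 \<in> I"
  proof (rule nd)
    fix x
    have "\<tau> (c * x) = (\<Sum>i<m. \<tau> (x * b i * b' i))"
      by (simp add: c_def sum_distrib_left dual_sum[OF \<tau>] mult_ac)
    also have "\<dots> = \<tau> x"
      by (simp add: trace_form_def[of m b g x] coord)
    finally show "\<tau> ((c - 1) * x) = 0"
      by (simp add: left_diff_distrib dual_diff[OF \<tau>])
  qed
  have N_sum: "(\<lambda>j. \<Sum>s\<in>S. f s j) \<in> N" if "\<And>s. s \<in> S \<Longrightarrow> f s \<in> N" for f and S :: "nat set"
    using that by (induction S rule: infinite_finite_induct) (auto intro: N_add N_I I_zero)
  have d_zero: "d 0 = (\<lambda>j. 0)"
    using d_scale[of 0 0] by simp
  have d_sum: "d (\<Sum>s\<in>S. f s) = (\<lambda>j. \<Sum>s\<in>S. d (f s) j)" for f and S :: "nat set"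
    by (induction S rule: infinite_finite_induct) (auto simp: d_add d_zero)
  \<comment> \<open>\<open>u\<close> contains the error of expanding \<open>a * b i\<close> over
    \<open>b\<close>, and \<open>w\<close> that of expanding \<open>a * b' l\<close> over
    \<open>b'\<close> under \<open>d\<close>. Both expansions produce the same double sum, so it
    cancels in \<open>w j - u j\<close> and leaves \<open>c * d a j\<close> by the Leibniz
    rule.\<close>
  define u where "u j = (\<Sum>i<m. (a * b i - (\<Sum>l<m. scale (\<tau> (a * b i * b' l)) (b l))) * d (b' i) j)" for j
  have "u \<in> N"
    unfolding u_def
    using expand by (intro N_I I_sum) (auto simp: mult.commute[of _ "d _ _"] intro: I_mult)
  define w where "w j = (\<Sum>l<m. b l * d (a * b' l - (\<Sum>i<m. scale (\<tau> (a * b' l * b i)) (b' i))) j)" for j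
  have "w \<in> N"
    unfolding w_def by (intro N_sum N_mult d_I expand')
  have d_diff: "d (x - y) j = d x j - d y j" for x y j
    using d_add[of "x - y" y] by (simp add: fun_eq_iff)
  have w: "w j + (\<Sum>l<m. \<Sum>i<m. scale (\<tau> (a * b i * b' l)) (b l * d (b' i) j)) =
      a * (\<Sum>l<m. b l * d (b' l) j) + c * d a j" for j
    by (simp add: w_def d_diff d_sum d_mult d_scale sum_subtractf right_diff_distrib distrib_left
        sum.distrib sum_distrib_left sum_distrib_right c_def mult_scale mult_ac)
  have u: "u j + (\<Sum>l<m. \<Sum>i<m. scale (\<tau> (a * b i * b' l)) (b l * d (b' i) j)) =
      a * (\<Sum>l<m. b l * d (b' l) j)" for j
    by (subst sum.swap) (simp add: u_def sum_subtractf left_diff_distrib sum_distrib_left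
        sum_distrib_right scale_mult[symmetric] mult.assoc)
  have "w j - u j = c * d a j" for j
    using arg_cong2[of _ _ _ _ "(-)", OF w[of j] u[of j]] by simp
  \<comment> \<open>Replacing \<open>c\<close> by 1 costs only a multiple of \<open>c - 1\<close>,
    which lies in \<open>I\<close>.\<close>
  then have eq: "d a = (\<lambda>j. (w j + - 1 * u j) + - (c - 1) * d a j)"
    by (simp add: algebra_simps fun_eq_iff)
  have "(\<lambda>j. w j + - 1 * u j) \<in> N"
    by (rule N_add[OF \<open>w \<in> N\<close> N_mult[OF \<open>u \<in> N\<close>]])
  moreover have "(\<lambda>j. - (c - 1) * d a j) \<in> N"
    using I_mult[OF I_minus[OF c]] by (intro N_I) (simp only: mult.commute[of _ "d _ _"])
  ultimately have "(\<lambda>j. (w j + - 1 * u j) + - (c - 1) * d a j) \<in> N"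
    by (rule N_add)
  then show ?thesis
    using eq by simp
qed

end

end

section \<open>Multivariate polynomials\<close>

abbreviation mpol_var :: "nat \<Rightarrow> 'a :: comm_ring_1 mpol" where
  "mpol_var i \<equiv> Poly_Mapping.single (Poly_Mapping.single i (Suc 0)) 1"

lemma update_eq_add_single:
  fixes f :: "'a \<Rightarrow>\<^sub>0 'b :: comm_monoid_add"
  assumes "k \<notin> Poly_Mapping.keys f"
  shows "Poly_Mapping.update k v f = f + Poly_Mapping.single k v"
  using assms
  by (intro poly_mapping_eqI) (auto simp: lookup_update lookup_add lookup_single in_keys_iff when_def)

text \<open>The key type is arbitrary, so that the rule applies to exponent vectors as well as to
  polynomials.\<close>

lemma mpol_single_induct [case_names single add]:
  fixes p :: "'a \<Rightarrow>\<^sub>0 'b :: comm_monoid_add"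
  assumes single: "\<And>m c. P (Poly_Mapping.single m c)"
    and add: "\<And>p q. P p \<Longrightarrow> P q \<Longrightarrow> P (p + q)"
  shows "P p"
proof (induction p rule: update_induct)
  case const
  show ?case using single[of undefined 0] by simp
next
  case (update p m c)
  then show ?case by (simp add: update_eq_add_single single add)
qed

text \<open>Constants and variables generate the polynomials as a ring: powers of a variable first,
  then monomials, then sums. \<open>V = {..<n}\<close> describes \<open>mpol_ring n\<close>, and
  \<open>V = UNIV\<close> all polynomials.\<close>

lemma mpol_induct [consumes 1, case_names const var add mult]:
  fixes p :: "'a :: comm_ring_1 mpol"
  assumes p: "\<forall>m\<in>Poly_Mapping.keys p. Poly_Mapping.keys m \<subseteq> V"
    and Pconst: "\<And>c. P (Poly_Mapping.single 0 c)"
    and Pvar: "\<And>i. i \<in> V \<Longrightarrow> P (mpol_var i)"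
    and Padd: "\<And>p q. P p \<Longrightarrow> P q \<Longrightarrow> P (p + q)"
    and Pmult: "\<And>p q. P p \<Longrightarrow> P q \<Longrightarrow> P (p * q)"
  shows "P p"
proof -
  have power: "P (Poly_Mapping.single (Poly_Mapping.single i k) 1)" if "i \<in> V" for i k
  proof (induction k)
    case 0
    show ?case using Pconst[of 1] by simp
  next
    case (Suc k)
    have "Poly_Mapping.single (Poly_Mapping.single i (Suc k)) (1 :: 'a) =
        mpol_var i * Poly_Mapping.single (Poly_Mapping.single i k) 1"
      by (simp add: mult_single single_add[symmetric])
    then show ?case using Pmult[OF Pvar[OF that] Suc] by simp
  qed
  have monom: "Poly_Mapping.keys m \<subseteq> V \<Longrightarrow> P (Poly_Mapping.single m 1)" for m
  proof (induction m rule: update_induct)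
    case const
    show ?case using Pconst[of 1] by simp
  next
    case (update m i k)
    have "Poly_Mapping.single (m + Poly_Mapping.single i k) (1 :: 'a) =
        Poly_Mapping.single m 1 * Poly_Mapping.single (Poly_Mapping.single i k) 1"
      by (simp add: mult_single)
    moreover have "i \<in> V" "Poly_Mapping.keys m \<subseteq> V"
      using update.prems update.hyps by (simp_all add: keys_update)
    ultimately show ?case
      using Pmult[OF update.IH power] update.hyps by (simp add: update_eq_add_single)
  qed
  show ?thesis
    using p
  proof (induction p rule: update_induct)
    case const
    show ?case using Pconst[of 0] by simp
  next
    case (update p m c)
    have "Poly_Mapping.single m c = Poly_Mapping.single 0 c * Poly_Mapping.single m 1"
      by (simp add: mult_single)
    moreover have "Poly_Mapping.keys m \<subseteq> V"
      using update.prems update.hyps by (simp add: keys_update)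
    ultimately have "P (Poly_Mapping.single m c)"
      using Pmult[OF Pconst monom] by simp
    moreover have "P p"
      using update.prems update.hyps by (intro update.IH) (simp add: keys_update)
    ultimately show ?case
      using update.hyps by (simp add: update_eq_add_single Padd)
  qed
qed

section \<open>Evaluation homomorphisms\<close>

definition monom_value :: "(nat \<Rightarrow> 'b :: comm_ring_1) \<Rightarrow> (nat \<Rightarrow>\<^sub>0 nat) \<Rightarrow> 'b" where
  "monom_value \<theta> m = (\<Prod>i\<in>Poly_Mapping.keys m. \<theta> i ^ Poly_Mapping.lookup m i)"

lemma monom_value_superset:
  assumes "finite S" "Poly_Mapping.keys m \<subseteq> S"
  shows "monom_value \<theta> m = (\<Prod>i\<in>S. \<theta> i ^ Poly_Mapping.lookup m i)"
  unfolding monom_value_def using assms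
  by (intro prod.mono_neutral_left) (auto simp: in_keys_iff)

lemma monom_value_add: "monom_value \<theta> (m + m') = monom_value \<theta> m * monom_value \<theta> m'"
proof -
  let ?S = "Poly_Mapping.keys m \<union> Poly_Mapping.keys m'"
  show ?thesis
    using keys_add[of m m']
    by (simp add: monom_value_superset[of ?S] lookup_add power_add prod.distrib)
qed

lemma monom_value_zero [simp]: "monom_value \<theta> 0 = 1"
  by (simp add: monom_value_def)

lemma monom_value_single [simp]: "monom_value \<theta> (Poly_Mapping.single i (Suc 0)) = \<theta> i"
  by (simp add: monom_value_def)

text \<open>For a ring homomorphism \<open>h\<close> this is the extension given by the universal
  property of polynomial rings. The second copy of K[X], the restriction to the diagonal and the
  truncation of variables are all instances.\<close>

definition insertion ::
  "('a \<Rightarrow> 'b) \<Rightarrow> (nat \<Rightarrow> 'b) \<Rightarrow> 'a :: comm_ring_1 mpol \<Rightarrow> 'b :: comm_ring_1" where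
  "insertion h \<theta> p =
    (\<Sum>m\<in>Poly_Mapping.keys p. h (Poly_Mapping.lookup p m) * monom_value \<theta> m)"

context
  fixes h :: "'a :: comm_ring_1 \<Rightarrow> 'b :: comm_ring_1"
  assumes h: "comm_ring_hom h"
begin

interpretation h: comm_ring_hom h by (rule h)

lemma insertion_single: "insertion h \<theta> (Poly_Mapping.single m c) = h c * monom_value \<theta> m"
  by (simp add: insertion_def)

lemma insertion_var: "insertion h \<theta> (mpol_var i) = \<theta> i"
  by (simp add: insertion_single)

lemma insertion_add: "insertion h \<theta> (p + q) = insertion h \<theta> p + insertion h \<theta> q"
  unfolding insertion_def by (rule setsum_keys_plus_distrib) (simp_all add: h.hom_add distrib_right)

lemma insertion_mult: "insertion h \<theta> (p * q) = insertion h \<theta> p * insertion h \<theta> q"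
proof (induction p rule: mpol_single_induct)
  case (single m c)
  show ?case
  proof (induction q rule: mpol_single_induct)
    case (single m' c')
    show ?case by (simp add: mult_single insertion_single h.hom_mult monom_value_add mult_ac)
  next
    case (add q q')
    then show ?case by (simp add: distrib_left insertion_add)
  qed
next
  case (add p p')
  then show ?case by (simp add: distrib_right insertion_add)
qed

lemma insertion_hom: "comm_ring_hom (insertion h \<theta>)"
proof
  show "insertion h \<theta> 1 = 1"
    using insertion_single[of \<theta> 0 1] by simp
  show "insertion h \<theta> 0 = 0"
    by (simp add: insertion_def)
qed (simp_all add: insertion_add insertion_mult)

end

lemma comm_ring_hom_id: "comm_ring_hom (id :: 'a :: comm_ring_1 \<Rightarrow> 'a)"
  by unfold_locales simp_all

lemma comm_ring_hom_const:
  "comm_ring_hom (Poly_Mapping.single 0 :: 'a :: comm_ring_1 \<Rightarrow> 'm :: comm_monoid_add \<Rightarrow>\<^sub>0 'a)"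
  by unfold_locales (simp_all add: single_add mult_single)

lemma comm_ring_hom_comp:
  assumes "comm_ring_hom f" "comm_ring_hom g"
  shows "comm_ring_hom (\<lambda>x. f (g x))"
proof -
  interpret f: comm_ring_hom f by fact
  interpret g: comm_ring_hom g by fact
  show ?thesis
    by unfold_locales (simp_all add: f.hom_add g.hom_add f.hom_mult g.hom_mult)
qed

lemma monom_value_var: "monom_value mpol_var m = Poly_Mapping.single m (1 :: 'a :: comm_ring_1)"
proof (induction m rule: mpol_single_induct)
  case (single i k)
  show ?case
  proof (induction k)
    case (Suc k)
    have "Poly_Mapping.single i (Suc k) = Poly_Mapping.single i (Suc 0) + Poly_Mapping.single i k"
      by (simp add: single_add[symmetric])
    then show ?case
      by (simp only: monom_value_add Suc monom_value_single) (simp add: mult_single)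
  qed simp
next
  case (add m m')
  then show ?case by (simp add: monom_value_add mult_single)
qed

section \<open>Partial derivatives\<close>

lemma pderiv_single:
  "mpol_pderiv j (Poly_Mapping.single m c) =
    Poly_Mapping.single (m - Poly_Mapping.single j 1) (of_nat (Poly_Mapping.lookup m j) * c)"
  by (simp add: mpol_pderiv_def)

lemma pderiv_add: "mpol_pderiv j (p + q) = mpol_pderiv j p + mpol_pderiv j q"
  unfolding mpol_pderiv_def
  by (rule setsum_keys_plus_distrib) (simp_all add: distrib_left single_add)

lemma pderiv_const: "mpol_pderiv j (Poly_Mapping.single 0 c) = 0"
  by (simp add: pderiv_single)

lemma pderiv_zero: "mpol_pderiv j 0 = 0"
  by (simp add: mpol_pderiv_def)

lemma pderiv_var: "mpol_pderiv j (mpol_var i) = (if i = j then 1 else 0)"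
  by (simp add: pderiv_single lookup_single when_def)

lemma pderiv_mult: "mpol_pderiv j (p * q) = p * mpol_pderiv j q + q * mpol_pderiv j p"
proof (induction p rule: mpol_single_induct)
  case (single m c)
  show ?case
  proof (induction q rule: mpol_single_induct)
    case (single m' c')
    let ?e = "Poly_Mapping.single j (Suc 0)"
    \<comment> \<open>Subtraction of exponents is truncated, so \<open>?e\<close> can be moved past
      \<open>a\<close> only if \<open>b\<close> has a positive exponent at \<open>j\<close>;
      otherwise the coefficient is 0.\<close>
    have shift: "Poly_Mapping.single (a + b - ?e) (of_nat (Poly_Mapping.lookup b j) * d) =
        Poly_Mapping.single (a + (b - ?e)) (of_nat (Poly_Mapping.lookup b j) * d)" for a b and d :: 'a
    proof (cases "Poly_Mapping.lookup b j = 0")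
      case False
      then have "a + b - ?e = a + (b - ?e)"
        by (intro poly_mapping_eqI) (auto simp: lookup_add lookup_minus lookup_single when_def)
      then show ?thesis by simp
    qed simp
    have "mpol_pderiv j (Poly_Mapping.single m c * Poly_Mapping.single m' c') =
        Poly_Mapping.single (m + m' - ?e) (of_nat (Poly_Mapping.lookup m' j) * (c * c')) +
        Poly_Mapping.single (m' + m - ?e) (of_nat (Poly_Mapping.lookup m j) * (c * c'))"
      by (simp add: pderiv_single mult_single lookup_add distrib_right single_add add.commute)
    then show ?case
      unfolding shift by (simp add: pderiv_single mult_single mult_ac)
  next
    case (add q q')
    then show ?case by (simp add: distrib_left distrib_right pderiv_add)
  qed
next
  case (add p p')
  then show ?case by (simp add: distrib_left distrib_right pderiv_add)
qed

section \<open>Doubled variables and divided differences\<close>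

text \<open>The ring \<open>K[X][Y]\<close>, which contains \<open>K[X]\<close> as the constants and a second copy \<open>K[Y]\<close>, and the
  restriction to the diagonal \<open>Y = X\<close>.\<close>

abbreviation in_X :: "'k :: comm_ring_1 mpol \<Rightarrow> 'k mpol mpol" where
  "in_X \<equiv> Poly_Mapping.single 0"

definition in_Y :: "'k :: comm_ring_1 mpol \<Rightarrow> 'k mpol mpol" where
  "in_Y = insertion (\<lambda>c. in_X (Poly_Mapping.single 0 c)) mpol_var"

definition diag :: "'k :: comm_ring_1 mpol mpol \<Rightarrow> 'k mpol" where
  "diag = insertion id mpol_var"

lemma in_X_hom: "comm_ring_hom in_X"
  by (rule comm_ring_hom_const)

lemma double_const_hom: "comm_ring_hom (\<lambda>c. in_X (Poly_Mapping.single 0 c))"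
  by (rule comm_ring_hom_comp[OF in_X_hom comm_ring_hom_const])

lemma in_Y_hom: "comm_ring_hom in_Y"
  unfolding in_Y_def by (intro insertion_hom double_const_hom)

lemma diag_hom: "comm_ring_hom diag"
  unfolding diag_def by (intro insertion_hom comm_ring_hom_id)

interpretation in_X: comm_ring_hom in_X by (rule in_X_hom)
interpretation in_Y: comm_ring_hom in_Y by (rule in_Y_hom)
interpretation diag: comm_ring_hom diag by (rule diag_hom)

lemma in_Y_var: "in_Y (mpol_var i) = mpol_var i"
  unfolding in_Y_def by (rule insertion_var[OF double_const_hom])

lemma in_Y_const: "in_Y (Poly_Mapping.single 0 c) = in_X (Poly_Mapping.single 0 c)"
  unfolding in_Y_def by (simp add: insertion_single[OF double_const_hom])

lemma diag_in_X: "diag (in_X p) = p"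
  unfolding diag_def by (simp add: insertion_single[OF comm_ring_hom_id])

lemma diag_var: "diag (mpol_var i) = mpol_var i"
  unfolding diag_def by (rule insertion_var[OF comm_ring_hom_id])

lemma diag_in_Y: "diag (in_Y p) = p"
  by (rule mpol_induct[where V = UNIV])
    (simp_all only: in_Y_var in_Y_const diag_var diag_in_X in_Y.hom_add in_Y.hom_mult diag.hom_add
      diag.hom_mult subset_UNIV ball_triv simp_thms)

text \<open>In the difference, the outer \<open>mpol_var j\<close> is Y_j. Products are handled by
  p(X)q(X) - p(Y)q(Y) = p(X)(q(X) - q(Y)) + q(Y)(p(X) - p(Y)), which restricts to the Leibniz rule
  on the diagonal.\<close>

lemma divided_differences:
  fixes p :: "'k :: field mpol"
  assumes "p \<in> carrier (mpol_ring n)"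
  shows "\<exists>D. in_X p - in_Y p = (\<Sum>j<n. D j * (in_X (mpol_var j) - mpol_var j)) \<and>
    (\<forall>j. diag (D j) = mpol_pderiv j p)"
proof -
  have "\<forall>m\<in>Poly_Mapping.keys p. Poly_Mapping.keys m \<subseteq> {..<n}"
    using assms by (simp add: mpol_ring_def)
  then show ?thesis
  proof (induction p rule: mpol_induct)
    case (const c)
    show ?case
      by (intro exI[of _ "\<lambda>_. 0"]) (simp add: in_Y_const pderiv_const)
  next
    case (var i)
    have "(\<Sum>j<n. (if i = j then 1 else 0) * (in_X (mpol_var j) - mpol_var j)) =
        (\<Sum>j<n. if i = j then in_X (mpol_var j :: 'k mpol) - mpol_var j else 0)"
      by (intro sum.cong) simp_all
    also have "\<dots> = in_X (mpol_var i) - mpol_var i"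
      using var by simp
    finally show ?case
      by (intro exI[of _ "\<lambda>j. if i = j then 1 else 0"]) (simp add: in_Y_var pderiv_var)
  next
    case (add p q)
    then obtain D E where
      "in_X p - in_Y p = (\<Sum>j<n. D j * (in_X (mpol_var j) - mpol_var j))"
      "in_X q - in_Y q = (\<Sum>j<n. E j * (in_X (mpol_var j) - mpol_var j))"
      "\<And>j. diag (D j) = mpol_pderiv j p" "\<And>j. diag (E j) = mpol_pderiv j q" by blast
    then show ?case
      by (intro exI[of _ "\<lambda>j. D j + E j"])
        (simp add: in_X.hom_add in_Y.hom_add distrib_right sum.distrib diag.hom_add pderiv_add
          add_diff_add)
  next
    case (mult p q)
    then obtain D E where
      D: "in_X p - in_Y p = (\<Sum>j<n. D j * (in_X (mpol_var j) - mpol_var j))"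
      "\<And>j. diag (D j) = mpol_pderiv j p" and
      E: "in_X q - in_Y q = (\<Sum>j<n. E j * (in_X (mpol_var j) - mpol_var j))"
      "\<And>j. diag (E j) = mpol_pderiv j q" by blast
    have "in_X (p * q) - in_Y (p * q) =
        in_X p * (in_X q - in_Y q) + in_Y q * (in_X p - in_Y p)"
      by (simp add: in_X.hom_mult in_Y.hom_mult algebra_simps)
    also have "\<dots> = (\<Sum>j<n. (in_X p * E j + in_Y q * D j) * (in_X (mpol_var j) - mpol_var j))"
      unfolding D E by (simp add: sum_distrib_left distrib_right sum.distrib mult.assoc)
    finally show ?case
      using D(2) E(2)
      by (intro exI[of _ "\<lambda>j. in_X p * E j + in_Y q * D j"])
        (simp add: diag.hom_add diag.hom_mult diag_in_X diag_in_Y pderiv_mult)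
  qed
qed

section \<open>Net algebras are separable\<close>

text \<open>These are ideals of the polynomial ring in all variables indexed by \<open>nat\<close>.
  For a presentation in \<open>n\<close> variables, the ideal will also contain the variables from
  index \<open>n\<close> on.\<close>

locale mpol_ideal =
  fixes I :: "'k :: field mpol set"
  assumes ideal_zero: "0 \<in> I"
    and ideal_add: "p \<in> I \<Longrightarrow> q \<in> I \<Longrightarrow> p + q \<in> I"
    and ideal_mult: "p \<in> I \<Longrightarrow> r * p \<in> I"

sublocale mpol_ideal \<subseteq> quotient_algebra "\<lambda>c p. Poly_Mapping.single 0 c * p" I
  by unfold_locales
    (auto simp: distrib_left distrib_right single_add mult_single mult.assoc[symmetric] ideal_zero
      ideal_add ideal_mult)

context mpol_ideal
begin

interpretation in_X: comm_ring_hom in_X by (rule in_X_hom)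
interpretation in_Y: comm_ring_hom in_Y by (rule in_Y_hom)
interpretation diag: comm_ring_hom diag by (rule diag_hom)

section \<open>Contraction by linear forms\<close>

text \<open>Applies a linear form to the second factor of \<open>K[X][Y] = K[X] \<otimes> K[Y]\<close>.\<close>

definition contract :: "('k mpol \<Rightarrow> 'k) \<Rightarrow> 'k mpol mpol \<Rightarrow> 'k mpol" where
  "contract g t = (\<Sum>m\<in>Poly_Mapping.keys t.
    Poly_Mapping.single 0 (g (Poly_Mapping.single m 1)) * Poly_Mapping.lookup t m)"

lemma contract_single:
  "contract g (Poly_Mapping.single m p) = Poly_Mapping.single 0 (g (Poly_Mapping.single m 1)) * p"
  by (simp add: contract_def)

lemma contract_add: "contract g (s + t) = contract g s + contract g t"
  unfolding contract_def by (rule setsum_keys_plus_distrib) (simp_all add: distrib_left)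

lemma contract_zero: "contract g 0 = 0"
  by (simp add: contract_def)

lemma contract_diff: "contract g (s - t) = contract g s - contract g t"
  using contract_add[of g "s - t" t] by simp

lemma contract_single_mult:
  "contract g (Poly_Mapping.single m p * t) = p * contract (\<lambda>x. g (Poly_Mapping.single m 1 * x)) t"
proof (induction t rule: mpol_single_induct)
  case (single m' q)
  show ?case by (simp add: mult_single contract_single mult_ac)
next
  case (add s t)
  then show ?case by (simp add: distrib_left contract_add)
qed

lemma contract_in_X_mult: "contract g (in_X p * t) = p * contract g t"
  by (simp add: contract_single_mult)

lemma contract_in_Y_mult:
  assumes "g \<in> dual"
  shows "contract g (in_Y a * t) = contract (\<lambda>x. g (a * x)) t"
proof -
  \<comment> \<open>The form is quantified inside the induction: in the product case the hypothesis
    for \<open>q\<close> is applied to the form \<open>\<lambda>x. g (p * x)\<close>.\<close>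
  have "\<forall>g\<in>dual. \<forall>t. contract g (in_Y a * t) = contract (\<lambda>x. g (a * x)) t"
  proof (rule mpol_induct[where V = UNIV and p = a])
    fix c :: 'k
    show "\<forall>g\<in>dual. \<forall>t. contract g (in_Y (Poly_Mapping.single 0 c) * t) =
        contract (\<lambda>x. g (Poly_Mapping.single 0 c * x)) t"
    proof (intro ballI allI)
      fix g t
      assume g: "g \<in> dual"
      have "contract (\<lambda>x. c * g x) t = Poly_Mapping.single 0 c * contract g t"
        unfolding contract_def sum_distrib_left
        by (intro sum.cong) (simp_all add: mult_single mult.assoc[symmetric])
      then show "contract g (in_Y (Poly_Mapping.single 0 c) * t) =
          contract (\<lambda>x. g (Poly_Mapping.single 0 c * x)) t"
        by (simp add: in_Y_const contract_in_X_mult dual_scale[OF g])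
    qed
  next
    fix i
    show "\<forall>g\<in>dual. \<forall>t. contract g (in_Y (mpol_var i) * t) = contract (\<lambda>x. g (mpol_var i * x)) t"
      by (simp add: in_Y_var contract_single_mult)
  next
    fix p q :: "'k mpol"
    assume p: "\<forall>g\<in>dual. \<forall>t. contract g (in_Y p * t) = contract (\<lambda>x. g (p * x)) t"
      and q: "\<forall>g\<in>dual. \<forall>t. contract g (in_Y q * t) = contract (\<lambda>x. g (q * x)) t"
    show "\<forall>g\<in>dual. \<forall>t. contract g (in_Y (p + q) * t) = contract (\<lambda>x. g ((p + q) * x)) t"
    proof (intro ballI allI)
      fix g t
      assume g: "g \<in> dual"
      have "contract (\<lambda>x. g ((p + q) * x)) t =
          contract (\<lambda>x. g (p * x)) t + contract (\<lambda>x. g (q * x)) t"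
        by (simp add: contract_def distrib_right dual_add[OF g] single_add sum.distrib)
      then show "contract g (in_Y (p + q) * t) = contract (\<lambda>x. g ((p + q) * x)) t"
        using p q g by (simp add: in_Y.hom_add distrib_right contract_add)
    qed
    show "\<forall>g\<in>dual. \<forall>t. contract g (in_Y (p * q) * t) = contract (\<lambda>x. g (p * q * x)) t"
    proof (intro ballI allI)
      fix g t
      assume g: "g \<in> dual"
      then show "contract g (in_Y (p * q) * t) = contract (\<lambda>x. g (p * q * x)) t"
        using p q dual_mult[OF g, of p] by (simp add: in_Y.hom_mult mult.assoc)
    qed
  qed simp
  then show ?thesis using assms by blast
qed

section \<open>The ideal of the tensor product\<close>

text \<open>The kernel of \<open>K[X][Y] \<rightarrow> (K[X]/I) \<otimes> (K[Y]/I)\<close>, described by duality.\<close>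

definition tensor_ideal :: "'k mpol mpol set" where
  "tensor_ideal = {t. \<forall>g\<in>dual. contract g t \<in> I}"

lemma tensor_ideal_zero: "0 \<in> tensor_ideal"
  by (simp add: tensor_ideal_def contract_zero I_zero)

lemma tensor_ideal_add: "s \<in> tensor_ideal \<Longrightarrow> t \<in> tensor_ideal \<Longrightarrow> s + t \<in> tensor_ideal"
  by (simp add: tensor_ideal_def contract_add I_add)

lemma tensor_ideal_diff: "s \<in> tensor_ideal \<Longrightarrow> t \<in> tensor_ideal \<Longrightarrow> s - t \<in> tensor_ideal"
  by (simp add: tensor_ideal_def contract_diff I_diff)

lemma tensor_ideal_sum: "(\<And>s. s \<in> S \<Longrightarrow> f s \<in> tensor_ideal) \<Longrightarrow> sum f S \<in> tensor_ideal"
  by (induction S rule: infinite_finite_induct) (auto simp: tensor_ideal_zero tensor_ideal_add)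

text \<open>A factor from K[X] comes out of the contraction, and a monomial in Y only replaces
  \<open>g\<close> by another form in \<open>dual\<close>.\<close>

lemma tensor_ideal_mult: "t \<in> tensor_ideal \<Longrightarrow> s * t \<in> tensor_ideal"
proof (induction s rule: mpol_single_induct)
  case (single m p)
  then show ?case
    using dual_mult by (auto simp: tensor_ideal_def contract_single_mult intro!: I_mult)
next
  case (add s s')
  then show ?case by (simp add: distrib_right tensor_ideal_add)
qed

lemma in_X_tensor_ideal: "p \<in> I \<Longrightarrow> in_X p \<in> tensor_ideal"
  by (simp add: tensor_ideal_def contract_single I_mult)

lemma in_Y_tensor_ideal:
  assumes p: "p \<in> I"
  shows "in_Y p \<in> tensor_ideal"
proof -
  have "contract g (in_Y p) = 0" if g: "g \<in> dual" for g
    using contract_in_Y_mult[OF g, of p 1] dual_I[OF g] p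
    by (simp add: contract_def I_mult mult.commute)
  then show ?thesis by (simp add: tensor_ideal_def I_zero)
qed

section \<open>The separability idempotent of a net algebra\<close>

text \<open>By the divided differences, the relations say that a matrix \<open>M\<close> with \<open>M = 1\<close> on the diagonal
  kills the vector of the \<open>X\<^sub>j - Y\<^sub>j\<close>; hence so does its determinant, which is the idempotent sought.\<close>

theorem net_imp_disc_nonzero:
  assumes vars: "\<And>j. j \<ge> n \<Longrightarrow> mpol_var j \<in> I"
    and fs: "set fs \<subseteq> I" "set fs \<subseteq> carrier (mpol_ring n)"
    and net: "\<And>k. k < n \<Longrightarrow> \<exists>u. \<forall>j<n.
      (\<Sum>i<length fs. mpol_pderiv j (fs ! i) * u i) \<sim> (if j = k then 1 else 0)"
  shows "\<exists>m b g. quotient_basis m b g \<and> disc m b g \<noteq> 0"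
proof -
  \<comment> \<open>The difference X_j - Y_j.\<close>
  define x :: "nat \<Rightarrow> 'k mpol mpol" where "x j = in_X (mpol_var j) - mpol_var j" for j
  have "\<forall>k\<in>{..<n}. \<exists>u. \<forall>j<n. (\<Sum>i<length fs. mpol_pderiv j (fs ! i) * u i) \<sim> (if j = k then 1 else 0)"
    using net by simp
  from bchoice[OF this] obtain u where u: "\<And>j k. j < n \<Longrightarrow> k < n \<Longrightarrow>
      (\<Sum>i<length fs. mpol_pderiv j (fs ! i) * u k i) \<sim> (if j = k then 1 else 0)"
    by auto
  have "\<forall>i\<in>{..<length fs}. \<exists>D. in_X (fs ! i) - in_Y (fs ! i) = (\<Sum>j<n. D j * x j) \<and>
      (\<forall>j. diag (D j) = mpol_pderiv j (fs ! i))"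
    unfolding x_def using fs(2) by (intro ballI divided_differences) auto
  from bchoice[OF this] obtain D where
    D: "\<And>i. i < length fs \<Longrightarrow> in_X (fs ! i) - in_Y (fs ! i) = (\<Sum>j<n. D i j * x j)" and
    diag_D: "\<And>i j. i < length fs \<Longrightarrow> diag (D i j) = mpol_pderiv j (fs ! i)"
    by auto
  \<comment> \<open>\<open>u k\<close> is a preimage of the k-th unit vector under the Jacobian map.
    Row \<open>k\<close> combines the divided differences with these coefficients: against
    \<open>x\<close> it gives a combination of the f_i(X) - f_i(Y), and on the diagonal the k-th
    unit vector modulo \<open>I\<close>.\<close>
  define M where "M = mat n n (\<lambda>(k, j). \<Sum>i<length fs. in_X (u k i) * D i j)"
  have M: "M \<in> carrier_mat n n" by (simp add: M_def)
  define E where "E = det M"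
  have Mx: "(\<Sum>j<n. M $$ (k, j) * x j) \<in> tensor_ideal" if k: "k < n" for k
  proof -
    have "(\<Sum>j<n. M $$ (k, j) * x j) = (\<Sum>i<length fs. in_X (u k i) * (\<Sum>j<n. D i j * x j))"
      using k unfolding sum_distrib_left
      by (subst sum.swap) (simp add: M_def sum_distrib_right mult.assoc)
    also have "\<dots> = (\<Sum>i<length fs. in_X (u k i) * (in_X (fs ! i) - in_Y (fs ! i)))"
      by (simp add: D)
    also have "\<dots> \<in> tensor_ideal"
      using fs(1)
      by (intro tensor_ideal_sum tensor_ideal_mult tensor_ideal_diff in_X_tensor_ideal
          in_Y_tensor_ideal) auto
    finally show ?thesis .
  qed
  \<comment> \<open>Cramer's rule: the adjugate times \<open>M\<close> is \<open>E\<close> times the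
    identity. For a variable of index at least \<open>n\<close>, both X_l and Y_l already vanish in
    the tensor product.\<close>
  have Ex: "x l * E \<in> tensor_ideal" for l
  proof (cases "l < n")
    case True
    note adj = adj_mat[OF M]
    have "x l * E = (\<Sum>j<n. if l = j then E * x j else 0)"
      using True by (simp add: mult.commute)
    also have "\<dots> = (\<Sum>j<n. (if l = j then E else 0) * x j)"
      by (intro sum.cong) simp_all
    also have "\<dots> = (\<Sum>j<n. (adj_mat M * M) $$ (l, j) * x j)"
      using True by (intro sum.cong) (simp_all add: adj(3) E_def)
    also have "\<dots> = (\<Sum>j<n. (\<Sum>k<n. adj_mat M $$ (l, k) * M $$ (k, j)) * x j)"
      using True adj(1) M
      by (intro sum.cong) (simp_all add: times_mat_def scalar_prod_def atLeast0LessThan)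
    also have "\<dots> = (\<Sum>k<n. adj_mat M $$ (l, k) * (\<Sum>j<n. M $$ (k, j) * x j))"
      unfolding sum_distrib_left sum_distrib_right by (subst sum.swap) (simp add: mult.assoc)
    also have "\<dots> \<in> tensor_ideal"
      by (intro tensor_ideal_sum tensor_ideal_mult Mx) simp
    finally show ?thesis .
  next
    case False
    then have "mpol_var l \<in> I" using vars by simp
    then have "x l \<in> tensor_ideal"
      using tensor_ideal_diff[OF in_X_tensor_ideal in_Y_tensor_ideal, of "mpol_var l" "mpol_var l"]
      by (simp add: x_def in_Y_var)
    then show ?thesis
      using tensor_ideal_mult[of "x l" E] by (simp add: mult.commute)
  qed
  \<comment> \<open>The elements \<open>a\<close> with this property are closed under sums and
    products, by the splitting used for divided differences, so the case of variables
    suffices.\<close>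
  have kill: "(in_X a - in_Y a) * E \<in> tensor_ideal" for a
  proof (rule mpol_induct[where V = UNIV and p = a])
    fix c :: 'k
    show "(in_X (Poly_Mapping.single 0 c) - in_Y (Poly_Mapping.single 0 c)) * E \<in> tensor_ideal"
      by (simp add: in_Y_const tensor_ideal_zero)
  next
    fix i
    show "(in_X (mpol_var i) - in_Y (mpol_var i)) * E \<in> tensor_ideal"
      using Ex[of i] by (simp add: x_def in_Y_var)
  next
    fix p q :: "'k mpol"
    assume p: "(in_X p - in_Y p) * E \<in> tensor_ideal" and q: "(in_X q - in_Y q) * E \<in> tensor_ideal"
    show "(in_X (p + q) - in_Y (p + q)) * E \<in> tensor_ideal"
      using tensor_ideal_add[OF p q] by (simp add: in_X.hom_add in_Y.hom_add algebra_simps)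
    show "(in_X (p * q) - in_Y (p * q)) * E \<in> tensor_ideal"
      using tensor_ideal_add[OF tensor_ideal_mult[OF p, of "in_Y q"] tensor_ideal_mult[OF q, of "in_X p"]]
      by (simp add: in_X.hom_mult in_Y.hom_mult algebra_simps)
  qed simp
  show ?thesis
  proof (rule separable_imp_disc_nonzero)
    \<comment> \<open>As a polynomial in Y, \<open>E\<close> is a sum of tensors: the coefficients
      are the left factors, the monomials the right factors. Multiplying the factors is
      \<open>diag\<close>, and applying \<open>g\<close> to the right ones is
      \<open>contract g\<close>.\<close>
    show "finite (Poly_Mapping.keys E)" by simp
    have "(\<Sum>m\<in>Poly_Mapping.keys E. Poly_Mapping.lookup E m * Poly_Mapping.single m 1) = diag E"
      by (simp add: diag_def insertion_def monom_value_var)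
    also have "\<dots> = det (map_mat diag M)"
      by (simp add: E_def diag.hom_det)
    also have "\<dots> \<sim> det (1\<^sub>m n)"
    proof (rule cong_det)
      fix k j
      assume kj: "k < n" "j < n"
      have "map_mat diag M $$ (k, j) = (\<Sum>i<length fs. mpol_pderiv j (fs ! i) * u k i)"
        using kj
        by (simp add: M_def diag.hom_sum diag.hom_mult diag_in_X diag_D mult.commute)
      also have "\<dots> \<sim> (if j = k then 1 else 0)"
        using u kj by blast
      also have "\<dots> = 1\<^sub>m n $$ (k, j)"
        using kj by simp
      finally show "map_mat diag M $$ (k, j) \<sim> 1\<^sub>m n $$ (k, j)" .
    qed (simp_all add: M_def)
    finally show "(\<Sum>m\<in>Poly_Mapping.keys E. Poly_Mapping.lookup E m * Poly_Mapping.single m 1) \<sim> 1"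
      by simp
  next
    fix g a
    assume g: "g \<in> dual"
    have "contract g ((in_X a - in_Y a) * E) = a * contract g E - contract (\<lambda>x. g (a * x)) E"
      by (simp add: left_diff_distrib contract_diff contract_in_X_mult contract_in_Y_mult[OF g])
    then have "a * contract g E \<sim> contract (\<lambda>x. g (a * x)) E"
      using kill[of a] g by (auto simp: cong_def tensor_ideal_def)
    then show "a * (\<Sum>m\<in>Poly_Mapping.keys E.
          Poly_Mapping.single 0 (g (Poly_Mapping.single m 1)) * Poly_Mapping.lookup E m) \<sim>
        (\<Sum>m\<in>Poly_Mapping.keys E.
          Poly_Mapping.single 0 (g (a * Poly_Mapping.single m 1)) * Poly_Mapping.lookup E m)"
      by (simp add: contract_def)
  qed
qed

end

section \<open>Presented algebras\<close>

locale presented_algebra =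
  fixes A :: "('k :: field, 'a) module"
    and n :: nat
    and fs :: "'k mpol list"
    and \<phi> :: "'k mpol set \<Rightarrow> 'a"
  assumes presentation: "presentation A n fs \<phi>"
begin

sublocale A: algebra "class_ring :: 'k ring" A
  using presentation by (simp add: presentation_def)

lemma fs_closed: "set fs \<subseteq> carrier (mpol_ring n)"
  using presentation by (simp add: presentation_def)

sublocale rel: ideal "rel_ideal n fs" "mpol_ring n"
  by (rule rel_ideal_ideal[OF fs_closed])

section \<open>Evaluation of polynomials in \<open>A\<close>\<close>

abbreviation "ev \<equiv> eval_in n fs \<phi>"

lemma phi_ring_hom: "\<phi> \<in> Ring.ring_hom (fp_algebra n fs) A"
  and phi_bij: "bij_betw \<phi> (carrier (fp_algebra n fs)) (carrier A)"
  and phi_module_hom: "\<phi> \<in> LinearCombinations.module_hom class_ring (fp_algebra n fs) A"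
  using presentation by (auto simp: presentation_def algebra_iso_def ring_iso_def)

lemma fp_algebra_simps:
  "carrier (fp_algebra n fs) = carrier (mpol_ring n Quot rel_ideal n fs)"
  "mult (fp_algebra n fs) = mult (mpol_ring n Quot rel_ideal n fs)"
  "one (fp_algebra n fs) = one (mpol_ring n Quot rel_ideal n fs)"
  "zero (fp_algebra n fs) = zero (mpol_ring n Quot rel_ideal n fs)"
  "add (fp_algebra n fs) = add (mpol_ring n Quot rel_ideal n fs)"
  "smult (fp_algebra n fs) c x =
    (rel_ideal n fs +>\<^bsub>mpol_ring n\<^esub> mpol_const c) \<otimes>\<^bsub>mpol_ring n Quot rel_ideal n fs\<^esub> x"
  by (simp_all add: fp_algebra_def Let_def)

lemma mpol_ring_simps:
  fixes p q :: "'k mpol"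
  shows
  "p \<otimes>\<^bsub>mpol_ring n\<^esub> q = p * q" "p \<oplus>\<^bsub>mpol_ring n\<^esub> q = p + q"
  "\<one>\<^bsub>mpol_ring n\<^esub> = 1" "\<zero>\<^bsub>mpol_ring n\<^esub> = 0"
  by (simp_all add: mpol_ring_def)

lemma coset_hom: "(+>\<^bsub>mpol_ring n\<^esub>) (rel_ideal n fs) \<in> Ring.ring_hom (mpol_ring n) (fp_algebra n fs)"
  using rel.rcos_ring_hom by (simp add: Ring.ring_hom_def fp_algebra_simps)

lemma ev_ring_hom: "ev \<in> Ring.ring_hom (mpol_ring n) A"
  using ring_hom_trans[OF coset_hom phi_ring_hom] by (simp add: eval_in_def[abs_def] comp_def)

lemmas ev_closed = eval_closed[OF presentation]

lemma ev_add: "p \<in> carrier (mpol_ring n) \<Longrightarrow> q \<in> carrier (mpol_ring n) \<Longrightarrow> ev (p + q) = ev p \<oplus>\<^bsub>A\<^esub> ev q"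
  using ring_hom_add[OF ev_ring_hom] by (simp add: mpol_ring_simps)

lemma ev_mult: "p \<in> carrier (mpol_ring n) \<Longrightarrow> q \<in> carrier (mpol_ring n) \<Longrightarrow> ev (p * q) = ev p \<otimes>\<^bsub>A\<^esub> ev q"
  using ring_hom_mult[OF ev_ring_hom] by (simp add: mpol_ring_simps)

lemma const_closed: "Poly_Mapping.single 0 c \<in> carrier (mpol_ring n)"
  by (simp add: mpol_ring_def)

lemma ev_scale:
  assumes p: "p \<in> carrier (mpol_ring n)"
  shows "ev (Poly_Mapping.single 0 c * p) = c \<odot>\<^bsub>A\<^esub> ev p"
proof -
  let ?C = "\<lambda>p. rel_ideal n fs +>\<^bsub>mpol_ring n\<^esub> p"
  have "?C (Poly_Mapping.single 0 c * p) = c \<odot>\<^bsub>fp_algebra n fs\<^esub> ?C p"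
    using ring_hom_mult[OF coset_hom const_closed p, of c]
    by (simp add: fp_algebra_simps mpol_ring_simps mpol_const_def)
  moreover have "?C p \<in> carrier (fp_algebra n fs)"
    by (rule ring_hom_closed[OF coset_hom p])
  ultimately show ?thesis
    using phi_module_hom by (simp add: eval_in_def LinearCombinations.module_hom_def)
qed

lemma ev_surj:
  assumes "a \<in> carrier A"
  shows "\<exists>p\<in>carrier (mpol_ring n). ev p = a"
proof -
  have "a \<in> \<phi> ` carrier (fp_algebra n fs)"
    using bij_betw_imp_surj_on[OF phi_bij] assms by simp
  then show ?thesis
    by (auto simp: fp_algebra_simps FactRing_def A_RCOSETS_def' eval_in_def)
qed

lemma ev_kernel:
  assumes p: "p \<in> carrier (mpol_ring n)" and "ev p = \<zero>\<^bsub>A\<^esub>"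
  shows "p \<in> rel_ideal n fs"
proof -
  let ?C = "\<lambda>p. rel_ideal n fs +>\<^bsub>mpol_ring n\<^esub> p"
  have "ev 0 = \<zero>\<^bsub>A\<^esub>"
    using ev_add[of 0 0] ev_closed[of 0] by (simp add: mpol_ring_def)
  then have "\<phi> (?C p) = \<phi> (?C 0)"
    using assms(2) by (simp add: eval_in_def)
  moreover have "?C p \<in> carrier (fp_algebra n fs)" "?C 0 \<in> carrier (fp_algebra n fs)"
    using ring_hom_closed[OF coset_hom] p by (simp_all add: mpol_ring_def)
  ultimately have "?C p = ?C 0"
    using phi_bij by (auto simp: bij_betw_def inj_on_eq_iff)
  moreover have "?C 0 = rel_ideal n fs"
    using rel.a_rcos_const[OF additive_subgroup.zero_closed[OF rel.is_additive_subgroup]] by (simp add: mpol_ring_simps)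
  moreover have "p \<in> ?C p"
    using p by (rule rel.a_rcos_self)
  ultimately show ?thesis by simp
qed

section \<open>Passage to all variables\<close>

text \<open>Extending the presentation to all variables by \<open>X\<^sub>j \<mapsto> 0\<close> for \<open>j \<ge> n\<close> makes \<open>A\<close> a quotient of
  a type.\<close>

definition truncate :: "'k mpol \<Rightarrow> 'k mpol" where
  "truncate = insertion (Poly_Mapping.single 0) (\<lambda>j. if j < n then mpol_var j else 0)"

lemma truncate_hom: "comm_ring_hom truncate"
  unfolding truncate_def by (intro insertion_hom comm_ring_hom_const)

sublocale truncate: comm_ring_hom truncate by (rule truncate_hom)

lemma truncate_const: "truncate (Poly_Mapping.single 0 c) = Poly_Mapping.single 0 c"
  unfolding truncate_def by (simp add: insertion_single[OF comm_ring_hom_const])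

lemma truncate_var: "truncate (mpol_var j) = (if j < n then mpol_var j else 0)"
  unfolding truncate_def by (rule insertion_var[OF comm_ring_hom_const])

lemma mpol_ring_closed:
  fixes p q :: "'k mpol"
  shows
  "p \<in> carrier (mpol_ring n) \<Longrightarrow> q \<in> carrier (mpol_ring n) \<Longrightarrow> p + q \<in> carrier (mpol_ring n)"
  "p \<in> carrier (mpol_ring n) \<Longrightarrow> q \<in> carrier (mpol_ring n) \<Longrightarrow> p * q \<in> carrier (mpol_ring n)"
  using rel.a_closed[of p q] rel.m_closed[of p q] by (simp_all add: mpol_ring_simps)

lemma truncate_closed: "truncate p \<in> carrier (mpol_ring n)"
  by (rule mpol_induct[where V = UNIV])
    (simp_all add: truncate_const truncate_var truncate.hom_add truncate.hom_mult const_closed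
      mpol_ring_closed, simp_all add: mpol_ring_def)

lemma truncate_id:
  assumes "p \<in> carrier (mpol_ring n)"
  shows "truncate p = p"
proof -
  have "\<forall>m\<in>Poly_Mapping.keys p. Poly_Mapping.keys m \<subseteq> {..<n}"
    using assms by (simp add: mpol_ring_def)
  then show ?thesis
    by (induction p rule: mpol_induct)
      (simp_all add: truncate_const truncate_var truncate.hom_add truncate.hom_mult)
qed

definition val :: "'k mpol \<Rightarrow> 'a" where
  "val p = ev (truncate p)"

lemma val_closed [simp]: "val p \<in> carrier A"
  unfolding val_def by (intro ev_closed truncate_closed)

lemma val_add: "val (p + q) = val p \<oplus>\<^bsub>A\<^esub> val q"
  by (simp add: val_def truncate.hom_add ev_add truncate_closed)

lemma val_mult: "val (p * q) = val p \<otimes>\<^bsub>A\<^esub> val q"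
  by (simp add: val_def truncate.hom_mult ev_mult truncate_closed)

lemma val_zero: "val 0 = \<zero>\<^bsub>A\<^esub>"
  using val_add[of 0 0] val_closed[of 0] by simp

lemma val_minus: "val (- p) = \<ominus>\<^bsub>A\<^esub> val p"
  using val_add[of "- p" p] by (simp add: val_zero A.M.minus_equality)

lemma val_scale: "val (Poly_Mapping.single 0 c * p) = c \<odot>\<^bsub>A\<^esub> val p"
  by (simp add: val_def truncate.hom_mult truncate_const ev_scale truncate_closed)

lemma val_sum: "finite S \<Longrightarrow> val (sum f S) = (\<Oplus>\<^bsub>A\<^esub> s\<in>S. val (f s))"
  by (induction S rule: finite_induct) (simp_all add: val_zero val_add)

lemma val_surj:
  assumes "a \<in> carrier A"
  obtains p where "val p = a"
  using ev_surj[OF assms] by (metis truncate_id val_def)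

lemma val_eq_ev: "p \<in> carrier (mpol_ring n) \<Longrightarrow> val p = ev p"
  by (simp add: val_def truncate_id)

definition kern :: "'k mpol set" where
  "kern = {p. val p = \<zero>\<^bsub>A\<^esub>}"

sublocale mpol_ideal kern
  by unfold_locales (simp_all add: kern_def val_zero val_add val_mult)

lemma cong_iff: "cong p q \<longleftrightarrow> val p = val q"
proof -
  have "val (p - q) = val p \<ominus>\<^bsub>A\<^esub> val q"
    using val_add[of p "- q"] by (simp add: val_minus A.M.minus_eq)
  then show ?thesis
    unfolding cong_def unfolding kern_def by simp
qed

lemma var_kern: "j \<ge> n \<Longrightarrow> mpol_var j \<in> kern"
  using val_zero by (simp add: kern_def val_def truncate_var truncate.hom_zero)

lemma rel_ideal_kern:
  assumes "p \<in> rel_ideal n fs"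
  shows "p \<in> kern"
proof -
  have p: "p \<in> carrier (mpol_ring n)"
    using assms by (rule rel.a_Hcarr)
  have "rel_ideal n fs +>\<^bsub>mpol_ring n\<^esub> p = rel_ideal n fs +>\<^bsub>mpol_ring n\<^esub> 0"
    using rel.a_rcos_const[OF assms] rel.a_rcos_const[OF additive_subgroup.zero_closed[OF rel.is_additive_subgroup]] by (simp add: mpol_ring_simps)
  then have "ev p = ev 0"
    by (simp add: eval_in_def)
  then show ?thesis
    using val_zero p by (simp add: kern_def val_eq_ev mpol_ring_def)
qed

lemma fs_kern: "set fs \<subseteq> kern"
  using rel_ideal_kern rel.genideal_self[OF fs_closed] by (auto simp: rel_ideal_def)

lemma truncate_cong: "cong (truncate p) p"
  by (simp add: cong_iff val_def truncate_id truncate_closed)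


section \<open>The module of relations between differentials\<close>

text \<open>The preimage of the image of \<open>Ja\<close> under evaluation of the first
  \<open>n\<close> components; later components are unconstrained. The functions modulo
  \<open>relations\<close> thus represent \<Omega>.\<close>

definition relations :: "(nat \<Rightarrow> 'k mpol) set" where
  "relations = {v. \<exists>u. \<forall>j<n. cong (\<Sum>i<length fs. mpol_pderiv j (fs ! i) * u i) (v j)}"

lemma relations_add:
  assumes "v \<in> relations" "w \<in> relations"
  shows "(\<lambda>j. v j + w j) \<in> relations"
proof -
  obtain r s where "\<forall>j<n. cong (\<Sum>i<length fs. mpol_pderiv j (fs ! i) * r i) (v j)"
    "\<forall>j<n. cong (\<Sum>i<length fs. mpol_pderiv j (fs ! i) * s i) (w j)"
    using assms by (auto simp: relations_def)
  then show ?thesis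
    unfolding relations_def
    by (intro CollectI exI[of _ "\<lambda>i. r i + s i"]) (simp add: distrib_left sum.distrib cong_add)
qed

lemma relations_mult:
  assumes "v \<in> relations"
  shows "(\<lambda>j. r * v j) \<in> relations"
proof -
  obtain u where u: "\<forall>j<n. cong (\<Sum>i<length fs. mpol_pderiv j (fs ! i) * u i) (v j)"
    using assms by (auto simp: relations_def)
  have "cong (\<Sum>i<length fs. mpol_pderiv j (fs ! i) * (r * u i)) (r * v j)" if "j < n" for j
    using cong_mult_left[of "\<Sum>i<length fs. mpol_pderiv j (fs ! i) * u i" "v j" r] u that
    by (simp add: sum_distrib_left mult.left_commute)
  then show ?thesis
    unfolding relations_def by (intro CollectI exI[of _ "\<lambda>i. r * u i"]) simp
qed

lemma relations_cong:
  assumes "v \<in> relations" "\<And>j. j < n \<Longrightarrow> cong (v j) (w j)"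
  shows "w \<in> relations"
proof -
  obtain u where u: "\<forall>j<n. cong (\<Sum>i<length fs. mpol_pderiv j (fs ! i) * u i) (v j)"
    using assms by (auto simp: relations_def)
  then show ?thesis
    unfolding relations_def
    by (intro CollectI exI[of _ u] allI impI) (blast intro: cong_trans assms(2))
qed

lemma relations_kern:
  assumes "\<And>j. v j \<in> kern"
  shows "v \<in> relations"
proof (rule relations_cong)
  show "(\<lambda>_. 0) \<in> relations"
    unfolding relations_def by (intro CollectI exI[of _ "\<lambda>_. 0"]) simp
  show "cong 0 (v j)" for j
    using assms by (simp add: cong_def I_minus)
qed

text \<open>The members of the ideal whose gradient lies in \<open>relations\<close> again form an
  ideal, since in d(r q) = r dq + q dr the last term has entries in \<open>kern\<close>. It contains
  the generators, whose gradients are the columns of the matrix of \<open>Ja\<close>.\<close>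

lemma pderiv_relations_rel_ideal:
  assumes "p \<in> rel_ideal n fs"
  shows "(\<lambda>j. mpol_pderiv j p) \<in> relations"
proof -
  define J where "J = {q \<in> rel_ideal n fs. (\<lambda>j. mpol_pderiv j q) \<in> relations}"
  have mult: "r * q \<in> J" if q: "q \<in> J" and r: "r \<in> carrier (mpol_ring n)" for q r
  proof -
    have "(\<lambda>j. q * mpol_pderiv j r) \<in> relations"
      using q rel_ideal_kern ideal_mult
      by (intro relations_kern) (auto simp: J_def mult.commute[of q])
    then have "(\<lambda>j. mpol_pderiv j (r * q)) \<in> relations"
      using q relations_add[OF relations_mult[of "\<lambda>j. mpol_pderiv j q" r]]
      by (simp add: J_def pderiv_mult)
    then show ?thesis
      using q r rel.I_l_closed[of q r] by (simp add: J_def mpol_ring_simps)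
  qed
  have "ideal J (mpol_ring n)"
  proof (rule idealI)
    show "ring (mpol_ring n :: 'k mpol ring)"
      by (rule cring.axioms(1)[OF mpol_cring])
    show "subgroup J (add_monoid (mpol_ring n))"
    proof (rule group.subgroupI)
      show "Group.group (add_monoid (mpol_ring n :: 'k mpol ring))"
        by (rule rel.a_group)
      show "J \<subseteq> carrier (add_monoid (mpol_ring n))"
        using rel.a_Hcarr by (auto simp: J_def)
      have "0 \<in> J"
        using additive_subgroup.zero_closed[OF rel.is_additive_subgroup] relations_kern[of "\<lambda>_. 0"] ideal_zero by (simp add: J_def mpol_ring_simps pderiv_zero)
      then show "J \<noteq> {}" by blast
      fix q
      assume q: "q \<in> J"
      have "- 1 \<in> carrier (mpol_ring n :: 'k mpol ring)"
        by (simp add: mpol_ring_def)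
      then have "- q \<in> J"
        using mult[OF q, of "- 1"] by simp
      moreover have "q \<in> carrier (mpol_ring n)"
        using q rel.a_Hcarr by (simp add: J_def)
      then have "\<ominus>\<^bsub>mpol_ring n\<^esub> q = - q"
        by (intro rel.minus_equality) (simp_all add: mpol_ring_def)
      ultimately show "inv\<^bsub>add_monoid (mpol_ring n)\<^esub> q \<in> J"
        by (simp add: a_inv_def)
      fix q'
      assume "q' \<in> J"
      then show "q \<otimes>\<^bsub>add_monoid (mpol_ring n)\<^esub> q' \<in> J"
        using q rel.a_closed[of q q']
          additive_subgroup.a_closed[OF rel.is_additive_subgroup, of q q']
          relations_add[of "\<lambda>j. mpol_pderiv j q" "\<lambda>j. mpol_pderiv j q'"]
        by (simp add: J_def pderiv_add mpol_ring_simps)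
    qed
    show "r \<otimes>\<^bsub>mpol_ring n\<^esub> q \<in> J" "q \<otimes>\<^bsub>mpol_ring n\<^esub> r \<in> J"
      if "q \<in> J" "r \<in> carrier (mpol_ring n)" for q r
      using mult[OF that] by (simp_all add: mpol_ring_simps mult.commute)
  qed
  moreover have "set fs \<subseteq> J"
  proof
    fix f
    assume f: "f \<in> set fs"
    then obtain l where l: "l < length fs" "f = fs ! l"
      by (auto simp: in_set_conv_nth)
    have "(\<Sum>i<length fs. mpol_pderiv j (fs ! i) * (if i = l then 1 else 0)) = mpol_pderiv j f" for j
    proof -
      have "(\<Sum>i<length fs. mpol_pderiv j (fs ! i) * (if i = l then 1 else 0)) =
          (\<Sum>i<length fs. if i = l then mpol_pderiv j (fs ! i) else 0)"
        by (intro sum.cong) simp_all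
      then show ?thesis using l by simp
    qed
    then have "(\<lambda>j. mpol_pderiv j f) \<in> relations"
      unfolding relations_def by (intro CollectI exI[of _ "\<lambda>i. if i = l then 1 else 0"]) simp
    moreover have "f \<in> rel_ideal n fs"
      using f rel.genideal_self[OF fs_closed] by (auto simp: rel_ideal_def)
    ultimately show "f \<in> J" by (simp add: J_def)
  qed
  ultimately have "rel_ideal n fs \<subseteq> J"
    unfolding rel_ideal_def by (rule rel.genideal_minimal)
  then show ?thesis
    using assms by (auto simp: J_def)
qed

text \<open>For \<open>j < n\<close>, a variable of index at least \<open>n\<close> and its
  truncation 0 have the same j-th derivative. Products follow from the Leibniz rule and
  \<open>truncate_cong\<close>.\<close>

lemma pderiv_truncate: "j < n \<Longrightarrow> cong (mpol_pderiv j (truncate p)) (mpol_pderiv j p)"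
proof (rule mpol_induct[where V = UNIV and p = p])
  fix p q :: "'k mpol"
  assume p: "cong (mpol_pderiv j (truncate p)) (mpol_pderiv j p)"
    and q: "cong (mpol_pderiv j (truncate q)) (mpol_pderiv j q)"
  show "cong (mpol_pderiv j (truncate (p + q))) (mpol_pderiv j (p + q))"
    using p q by (simp add: truncate.hom_add pderiv_add cong_add)
  show "cong (mpol_pderiv j (truncate (p * q))) (mpol_pderiv j (p * q))"
    unfolding truncate.hom_mult pderiv_mult
    by (intro cong_add cong_mult truncate_cong p q)
qed (auto simp: truncate_const truncate_var truncate.hom_zero pderiv_var pderiv_zero pderiv_const)

text \<open>This makes the universal derivation from \<open>A\<close> to \<Omega> well
  defined.\<close>

lemma pderiv_relations:
  assumes "p \<in> kern"
  shows "(\<lambda>j. mpol_pderiv j p) \<in> relations"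
proof (rule relations_cong)
  have "truncate p \<in> rel_ideal n fs"
    using assms by (intro ev_kernel truncate_closed) (simp add: kern_def val_def)
  then show "(\<lambda>j. mpol_pderiv j (truncate p)) \<in> relations"
    by (rule pderiv_relations_rel_ideal)
qed (rule pderiv_truncate)

section \<open>Net algebras in terms of \<open>relations\<close>\<close>

lemma Ja_val:
  "Ja A n fs \<phi> (\<lambda>i\<in>{..<length fs}. val (u i)) =
    (\<lambda>j\<in>{..<n}. val (\<Sum>i<length fs. mpol_pderiv j (fs ! i) * u i))"
proof -
  have ev: "ev (mpol_pderiv j (fs ! i)) = val (mpol_pderiv j (fs ! i))" if "i < length fs" for i j
    using that fs_closed by (intro val_eq_ev[symmetric] pderiv_closed) auto
  have "(\<Oplus>\<^bsub>A\<^esub> i\<in>{..<length fs}. ev (mpol_pderiv j (fs ! i)) \<otimes>\<^bsub>A\<^esub> (\<lambda>i\<in>{..<length fs}. val (u i)) i) =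
      (\<Oplus>\<^bsub>A\<^esub> i\<in>{..<length fs}. val (mpol_pderiv j (fs ! i) * u i))" for j
    by (rule A.M.finsum_cong') (simp_all add: ev val_mult)
  then show ?thesis
    unfolding Ja_def by (simp add: val_sum)
qed

lemma PiE_val:
  assumes "v \<in> S \<rightarrow>\<^sub>E carrier A"
  obtains u where "v = (\<lambda>i\<in>S. val (u i))"
proof -
  define u where "u i = (SOME p. val p = v i)" for i
  have u: "val (u i) = v i" if "i \<in> S" for i
  proof -
    have "v i \<in> carrier A"
      using assms that by (rule PiE_mem)
    then obtain p where "val p = v i"
      by (rule val_surj)
    then show ?thesis
      unfolding u_def by (rule someI)
  qed
  have "v = (\<lambda>i\<in>S. val (u i))"
  proof
    fix i
    show "v i = (\<lambda>i\<in>S. val (u i)) i"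
      using u PiE_arb[OF assms] by (cases "i \<in> S") simp_all
  qed
  then show ?thesis by (rule that)
qed

text \<open>The image of \<open>Ja\<close> is a submodule, so surjectivity can be tested on the unit
  vectors.\<close>

lemma net_iff: "net A n fs \<phi> \<longleftrightarrow> (\<forall>k<n. (\<lambda>j. if j = k then 1 else 0) \<in> relations)"
proof
  assume "net A n fs \<phi>"
  then have surj: "Ja A n fs \<phi> ` ({..<length fs} \<rightarrow>\<^sub>E carrier A) = ({..<n} \<rightarrow>\<^sub>E carrier A)"
    using net_iff_Ja_surj[OF presentation] by simp
  show "\<forall>k<n. (\<lambda>j. if j = k then 1 else 0) \<in> relations"
  proof (intro allI impI)
    fix k
    assume "k < n"
    have "(\<lambda>j\<in>{..<n}. val (if j = k then 1 else 0)) \<in> Ja A n fs \<phi> ` ({..<length fs} \<rightarrow>\<^sub>E carrier A)"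
      unfolding surj by simp
    then obtain v where v: "(\<lambda>j\<in>{..<n}. val (if j = k then 1 else 0)) = Ja A n fs \<phi> v"
      "v \<in> {..<length fs} \<rightarrow>\<^sub>E carrier A"
      by (rule imageE)
    obtain u where u: "v = (\<lambda>i\<in>{..<length fs}. val (u i))"
      using PiE_val[OF v(2)] .
    have eq: "(\<lambda>j\<in>{..<n}. val (\<Sum>i<length fs. mpol_pderiv j (fs ! i) * u i)) =
        (\<lambda>j\<in>{..<n}. val (if j = k then 1 else 0))"
      using v(1)[symmetric] unfolding u Ja_val .
    have "cong (\<Sum>i<length fs. mpol_pderiv j (fs ! i) * u i) (if j = k then 1 else 0)" if "j < n" for j
      using fun_cong[OF eq, of j] that unfolding cong_iff by simp
    then show "(\<lambda>j. if j = k then 1 else 0) \<in> relations"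
      unfolding relations_def by blast
  qed
next
  assume unit: "\<forall>k<n. (\<lambda>j. if j = k then 1 else 0) \<in> relations"
  have all: "v \<in> relations" for v
  proof (rule relations_cong)
    have sum: "(\<lambda>j. \<Sum>k\<in>S. f k j) \<in> relations" if "\<And>k. k \<in> S \<Longrightarrow> f k \<in> relations" for f and S :: "nat set"
      using that
      by (induction S rule: infinite_finite_induct)
        (auto intro: relations_add relations_kern ideal_zero)
    show "(\<lambda>j. \<Sum>k<n. v k * (if j = k then 1 else 0)) \<in> relations"
      using unit by (intro sum relations_mult) simp
    fix j
    assume "j < n"
    have "(\<Sum>k<n. v k * (if j = k then 1 else 0)) = (\<Sum>k<n. if j = k then v k else 0)"
      by (intro sum.cong) simp_all
    then show "cong (\<Sum>k<n. v k * (if j = k then 1 else 0)) (v j)"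
      using \<open>j < n\<close> by simp
  qed
  have "Ja A n fs \<phi> ` ({..<length fs} \<rightarrow>\<^sub>E carrier A) = ({..<n} \<rightarrow>\<^sub>E carrier A)"
  proof
    show "Ja A n fs \<phi> ` ({..<length fs} \<rightarrow>\<^sub>E carrier A) \<subseteq> ({..<n} \<rightarrow>\<^sub>E carrier A)"
    proof (rule image_subsetI)
      fix v
      assume "v \<in> {..<length fs} \<rightarrow>\<^sub>E carrier A"
      then obtain u where "v = (\<lambda>i\<in>{..<length fs}. val (u i))" by (rule PiE_val)
      then show "Ja A n fs \<phi> v \<in> ({..<n} \<rightarrow>\<^sub>E carrier A)" by (simp add: Ja_val)
    qed
    show "({..<n} \<rightarrow>\<^sub>E carrier A) \<subseteq> Ja A n fs \<phi> ` ({..<length fs} \<rightarrow>\<^sub>E carrier A)"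
    proof
      fix w
      assume "w \<in> {..<n} \<rightarrow>\<^sub>E carrier A"
      then obtain v where w: "w = (\<lambda>i\<in>{..<n}. val (v i))" by (rule PiE_val)
      obtain u where u: "\<forall>j<n. cong (\<Sum>i<length fs. mpol_pderiv j (fs ! i) * u i) (v j)"
        using all[of v] by (auto simp: relations_def)
      have "Ja A n fs \<phi> (\<lambda>i\<in>{..<length fs}. val (u i)) = w"
        unfolding w Ja_val using u by (intro restrict_ext) (simp add: cong_iff)
      moreover have "(\<lambda>i\<in>{..<length fs}. val (u i)) \<in> {..<length fs} \<rightarrow>\<^sub>E carrier A"
        by simp
      ultimately show "w \<in> Ja A n fs \<phi> ` ({..<length fs} \<rightarrow>\<^sub>E carrier A)"
        by (metis imageI)
    qed
  qed
  then show "net A n fs \<phi>"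
    using net_iff_Ja_surj[OF presentation] by simp
qed

theorem net_iff_disc_nonzero:
  "net A n fs \<phi> \<longleftrightarrow> (\<exists>m b g. quotient_basis m b g \<and> disc m b g \<noteq> 0)"
proof
  assume "net A n fs \<phi>"
  then show "\<exists>m b g. quotient_basis m b g \<and> disc m b g \<noteq> 0"
    by (intro net_imp_disc_nonzero[OF var_kern fs_kern fs_closed])
      (simp_all add: net_iff relations_def)
next
  assume "\<exists>m b g. quotient_basis m b g \<and> disc m b g \<noteq> 0"
  then obtain m b g where qb: "quotient_basis m b g" "disc m b g \<noteq> 0" by blast
  \<comment> \<open>The derivation is the gradient, with values taken modulo
    \<open>relations\<close>. The gradient of the k-th variable is the k-th unit vector, which is
    what \<open>net_iff\<close> asks for.\<close>
  have "(\<lambda>j. mpol_pderiv j p) \<in> relations" for p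
  proof (rule derivation_mem_of_disc_nonzero[OF qb])
    show "(\<lambda>j. mpol_pderiv j (Poly_Mapping.single 0 c * x)) =
        (\<lambda>j. Poly_Mapping.single 0 c * mpol_pderiv j x)" for c x
      by (simp add: pderiv_mult pderiv_const)
  qed (auto simp: pderiv_add pderiv_mult intro: pderiv_relations relations_add relations_mult
      relations_kern)
  from this[of "mpol_var k" for k] show "net A n fs \<phi>"
    by (simp add: net_iff pderiv_var eq_commute[of _ "_ :: nat"])
qed

end

section \<open>Bases of \<open>A\<close> and coordinate vectors\<close>

lemma bij_betw_ex1_iff:
  assumes F: "bij_betw F S T" and PQ: "\<And>s. s \<in> S \<Longrightarrow> P s \<longleftrightarrow> Q (F s)"
  shows "(\<exists>!s. s \<in> S \<and> P s) \<longleftrightarrow> (\<exists>!t. t \<in> T \<and> Q t)"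
proof
  assume "\<exists>!s. s \<in> S \<and> P s"
  then obtain s where s: "s \<in> S" "P s" "\<And>s'. s' \<in> S \<Longrightarrow> P s' \<Longrightarrow> s' = s" by blast
  show "\<exists>!t. t \<in> T \<and> Q t"
  proof (rule ex1I[of _ "F s"])
    show "F s \<in> T \<and> Q (F s)"
      using s PQ bij_betwE[OF F] by blast
    fix t
    assume t: "t \<in> T \<and> Q t"
    then obtain s' where "s' \<in> S" "t = F s'"
      using bij_betw_imp_surj_on[OF F] by blast
    then show "t = F s"
      using s(3) PQ t by blast
  qed
next
  assume "\<exists>!t. t \<in> T \<and> Q t"
  then obtain t where t: "t \<in> T" "Q t" "\<And>t'. t' \<in> T \<Longrightarrow> Q t' \<Longrightarrow> t' = t" by blast
  obtain s where s: "s \<in> S" "t = F s"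
    using bij_betw_imp_surj_on[OF F] t(1) by blast
  show "\<exists>!s. s \<in> S \<and> P s"
  proof (rule ex1I[of _ s])
    show "s \<in> S \<and> P s"
      using s t PQ by blast
    fix s'
    assume s': "s' \<in> S \<and> P s'"
    then have "F s' = F s"
      using s t(3) PQ bij_betwE[OF F] by blast
    then show "s' = s"
      using s' s(1) bij_betw_imp_inj_on[OF F] by (simp add: inj_on_eq_iff)
  qed
qed

text \<open>Linear combinations over a set take coefficients indexed by its elements,
  \<open>coords\<close> takes them by position in the list. Distinctness makes the position of an
  element unique.\<close>

lemma bij_betw_coefficients_vec:
  assumes "distinct bs"
  shows "bij_betw (\<lambda>a. vec (length bs) (\<lambda>i. a (bs ! i))) (set bs \<rightarrow>\<^sub>E UNIV) (carrier_vec (length bs))"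
proof -
  define index where "index x = (THE i. i < length bs \<and> bs ! i = x)" for x
  have index: "index (bs ! i) = i" if "i < length bs" for i
    unfolding index_def using that assms
    by (intro the_equality) (auto simp: nth_eq_iff_index_eq)
  show ?thesis
  proof (rule bij_betwI[where g = "\<lambda>c. \<lambda>x\<in>set bs. c $ index x"])
    fix a :: "'a \<Rightarrow> 'b"
    assume a: "a \<in> set bs \<rightarrow>\<^sub>E UNIV"
    show "(\<lambda>x\<in>set bs. vec (length bs) (\<lambda>i. a (bs ! i)) $ index x) = a"
    proof
      fix x
      show "(\<lambda>x\<in>set bs. vec (length bs) (\<lambda>i. a (bs ! i)) $ index x) x = a x"
        using PiE_arb[OF a, of x] index
        by (cases "x \<in> set bs") (auto simp: in_set_conv_nth)
    qed
  next
    fix c :: "'b vec"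
    assume "c \<in> carrier_vec (length bs)"
    then show "vec (length bs) (\<lambda>i. (\<lambda>x\<in>set bs. c $ index x) (bs ! i)) = c"
      by (intro eq_vecI) (simp_all add: index)
  qed auto
qed

context presented_algebra
begin

lemma vectorspace: "vectorspace (class_ring :: 'k ring) A"
  by (intro vectorspace.intro A.module class_field)

interpretation V: vectorspace "class_ring :: 'k ring" A
  by (rule vectorspace)

lemma finsum_scale_val:
  "(\<Oplus>\<^bsub>A\<^esub> i\<in>{..<m :: nat}. c i \<odot>\<^bsub>A\<^esub> val (b i)) = val (\<Sum>i<m. Poly_Mapping.single 0 (c i) * b i)"
  by (simp add: val_sum val_scale)

text \<open>The criterion by unique coefficients, transported to vectors, so that the description in
  \<open>coords\<close> is known to denote.\<close>

lemma finite_basis_iff: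
  "finite_basis A bs \<longleftrightarrow> distinct bs \<and> set bs \<subseteq> carrier A \<and>
    (\<forall>x\<in>carrier A. \<exists>!c. c \<in> carrier_vec (length bs) \<and>
      x = (\<Oplus>\<^bsub>A\<^esub> i\<in>{..<length bs}. c $ i \<odot>\<^bsub>A\<^esub> bs ! i))"
proof (cases "distinct bs \<and> set bs \<subseteq> carrier A")
  case True
  let ?m = "length bs"
  let ?F = "\<lambda>a. vec ?m (\<lambda>i. a (bs ! i))"
  have inj: "inj_on ((!) bs) {..<?m}" and img: "(!) bs ` {..<?m} = set bs"
    using bij_betw_nth[of bs "{..<?m}" "set bs"] True by (simp_all add: bij_betw_def)
  have lincomb: "A.lincomb a (set bs) = (\<Oplus>\<^bsub>A\<^esub> i\<in>{..<?m}. ?F a $ i \<odot>\<^bsub>A\<^esub> bs ! i)" for a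
  proof -
    have "(\<lambda>v. a v \<odot>\<^bsub>A\<^esub> v) \<in> (!) bs ` {..<?m} \<rightarrow> carrier A"
      unfolding img using True by auto
    from A.M.finsum_reindex[OF this inj]
    have "A.lincomb a (set bs) = (\<Oplus>\<^bsub>A\<^esub> i\<in>{..<?m}. a (bs ! i) \<odot>\<^bsub>A\<^esub> bs ! i)"
      unfolding A.lincomb_def img by simp
    also have "\<dots> = (\<Oplus>\<^bsub>A\<^esub> i\<in>{..<?m}. ?F a $ i \<odot>\<^bsub>A\<^esub> bs ! i)"
      using True by (intro A.M.finsum_cong') (auto simp: subset_iff)
    finally show ?thesis .
  qed
  have "(\<exists>!a. a \<in> set bs \<rightarrow>\<^sub>E UNIV \<and> A.lincomb a (set bs) = x) \<longleftrightarrow>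
      (\<exists>!c. c \<in> carrier_vec ?m \<and> x = (\<Oplus>\<^bsub>A\<^esub> i\<in>{..<?m}. c $ i \<odot>\<^bsub>A\<^esub> bs ! i))" for x
    using True by (intro bij_betw_ex1_iff[OF bij_betw_coefficients_vec]) (auto simp: lincomb)
  then show ?thesis
    using V.basis_criterion[of "set bs"] True by (simp add: finite_basis_def Ball_def)
next
  case False
  then show ?thesis
    by (auto simp: finite_basis_def V.basis_def)
qed

lemma coords_eqI:
  assumes "finite_basis A bs" "c \<in> carrier_vec (length bs)"
    "x = (\<Oplus>\<^bsub>A\<^esub> i\<in>{..<length bs}. c $ i \<odot>\<^bsub>A\<^esub> bs ! i)" "x \<in> carrier A"
  shows "coords A bs x = c"
  unfolding coords_def using assms by (intro the1_equality) (auto simp: finite_basis_iff)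

lemma coords_unfold:
  assumes "finite_basis A bs" "x \<in> carrier A"
  shows "coords A bs x \<in> carrier_vec (length bs)"
    "x = (\<Oplus>\<^bsub>A\<^esub> i\<in>{..<length bs}. coords A bs x $ i \<odot>\<^bsub>A\<^esub> bs ! i)"
  using theI'[of "\<lambda>c. c \<in> carrier_vec (length bs) \<and>
      x = (\<Oplus>\<^bsub>A\<^esub> i\<in>{..<length bs}. c $ i \<odot>\<^bsub>A\<^esub> bs ! i)"] assms
  by (simp_all add: coords_def finite_basis_iff)

section \<open>Comparison of bases and discriminants of \<open>A\<close> with those modulo
  \<open>kern\<close>\<close>

lemma alg_disc_eq:
  assumes basis: "finite_basis A bs" and len: "length bs = m"
    and b: "\<And>i. i < m \<Longrightarrow> bs ! i = val (b i)"
    and coords: "\<And>i p. i < m \<Longrightarrow> coords A bs (val p) $ i = g i p"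
  shows "alg_disc A bs = disc m b g"
proof -
  have trace: "alg_trace A bs (val p) = trace_form m b g p" for p
    unfolding alg_trace_def trace_form_def mult_mat_def len
    by (intro sum.cong) (simp_all add: b val_mult[symmetric] coords)
  show ?thesis
    unfolding alg_disc_def disc_def len
    by (intro arg_cong[of _ _ det] cong_mat) (simp_all add: b val_mult[symmetric] trace)
qed

lemma quotient_basis_imp_finite_basis:
  assumes qb: "quotient_basis m b g"
  shows "\<exists>bs. finite_basis A bs \<and> alg_disc A bs = disc m b g"
proof -
  define bs where "bs = map (\<lambda>i. val (b i)) [0..<m]"
  have bs: "length bs = m" "\<And>i. i < m \<Longrightarrow> bs ! i = val (b i)"
    by (simp_all add: bs_def)
  \<comment> \<open>\<open>g i\<close> is 1 at \<open>b i\<close> and 0 at the other basis elements,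
    so it separates their values.\<close>
  have "inj_on (\<lambda>i. val (b i)) {0..<m}"
  proof (rule inj_onI)
    fix i j
    assume ij: "i \<in> {0..<m}" "j \<in> {0..<m}" "val (b i) = val (b j)"
    then have "cong (b i) (b j)"
      by (simp add: cong_iff)
    then have "g i (b i) = g i (b j)"
      using ij by (intro dual_cong[OF qb_dual[OF qb]]) simp_all
    then show "i = j"
      using ij qb_delta[OF qb] by (simp split: if_splits)
  qed
  then have "distinct bs"
    by (simp add: bs_def distinct_map)
  have expand: "val p = (\<Oplus>\<^bsub>A\<^esub> i\<in>{..<m}. vec m (\<lambda>i. g i p) $ i \<odot>\<^bsub>A\<^esub> bs ! i)" for p
  proof -
    have "(\<Oplus>\<^bsub>A\<^esub> i\<in>{..<m}. vec m (\<lambda>i. g i p) $ i \<odot>\<^bsub>A\<^esub> bs ! i) =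
        (\<Oplus>\<^bsub>A\<^esub> i\<in>{..<m}. g i p \<odot>\<^bsub>A\<^esub> val (b i))"
      by (rule A.M.finsum_cong') (simp_all add: bs)
    then show ?thesis
      using qb_expand[OF qb, of p] by (simp add: finsum_scale_val cong_iff)
  qed
  \<comment> \<open>Applying \<open>g l\<close> to an expansion modulo \<open>kern\<close> returns
    its l-th coefficient.\<close>
  have unique: "c = vec m (\<lambda>i. g i p)"
    if c: "c \<in> carrier_vec m" "val p = (\<Oplus>\<^bsub>A\<^esub> i\<in>{..<m}. c $ i \<odot>\<^bsub>A\<^esub> bs ! i)" for c p
  proof (rule eq_vecI)
    fix l
    assume "l < dim_vec (vec m (\<lambda>i. g i p))"
    then have l: "l < m" by simp
    have "(\<Oplus>\<^bsub>A\<^esub> i\<in>{..<m}. c $ i \<odot>\<^bsub>A\<^esub> bs ! i) = (\<Oplus>\<^bsub>A\<^esub> i\<in>{..<m}. c $ i \<odot>\<^bsub>A\<^esub> val (b i))"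
      by (rule A.M.finsum_cong') (simp_all add: bs)
    then have "cong p (\<Sum>i<m. Poly_Mapping.single 0 (c $ i) * b i)"
      using c(2) by (simp add: finsum_scale_val cong_iff)
    then have "g l p = (\<Sum>i<m. c $ i * g l (b i))"
      using dual_cong[OF qb_dual[OF qb l]]
      by (simp add: dual_sum[OF qb_dual[OF qb l]] dual_scale[OF qb_dual[OF qb l]])
    also have "\<dots> = (\<Sum>i<m. if l = i then c $ i else 0)"
      by (intro sum.cong) (simp_all add: qb_delta[OF qb l])
    finally show "c $ l = vec m (\<lambda>i. g i p) $ l"
      using l by simp
  qed (use c in simp)
  have basis: "finite_basis A bs"
    unfolding finite_basis_iff bs(1)
  proof (intro conjI ballI)
    show "set bs \<subseteq> carrier A" by (auto simp: bs_def)
    fix x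
    assume "x \<in> carrier A"
    then obtain p where p: "val p = x" by (rule val_surj)
    show "\<exists>!c. c \<in> carrier_vec m \<and> x = (\<Oplus>\<^bsub>A\<^esub> i\<in>{..<m}. c $ i \<odot>\<^bsub>A\<^esub> bs ! i)"
    proof (rule ex1I[of _ "vec m (\<lambda>i. g i p)"])
      show "vec m (\<lambda>i. g i p) \<in> carrier_vec m \<and>
          x = (\<Oplus>\<^bsub>A\<^esub> i\<in>{..<m}. vec m (\<lambda>i. g i p) $ i \<odot>\<^bsub>A\<^esub> bs ! i)"
        using expand[of p] p by simp
    qed (use unique p in blast)
  qed fact
  have "coords A bs (val p) = vec m (\<lambda>i. g i p)" for p
    using coords_eqI[OF basis, unfolded bs(1), OF vec_carrier expand val_closed] .
  then have "alg_disc A bs = disc m b g"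
    by (intro alg_disc_eq[OF basis bs]) simp_all
  with basis show ?thesis by blast
qed

lemma finite_basis_imp_quotient_basis:
  assumes basis: "finite_basis A bs"
  shows "\<exists>m b g. quotient_basis m b g \<and> alg_disc A bs = disc m b g"
proof -
  define m where "m = length bs"
  define b where "b i = (SOME p. val p = bs ! i)" for i
  define g where "g i p = coords A bs (val p) $ i" for i p
  have carrier: "set bs \<subseteq> carrier A"
    using basis by (simp add: finite_basis_iff)
  have b: "bs ! i = val (b i)" if "i < m" for i
  proof -
    have "bs ! i \<in> carrier A"
      using that carrier by (auto simp: m_def)
    then obtain p where "val p = bs ! i"
      by (rule val_surj)
    then show ?thesis
      unfolding b_def by (rule someI[THEN sym])
  qed
  \<comment> \<open>By uniqueness of coordinates, any expansion modulo \<open>kern\<close>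
    determines \<open>g\<close>. Linearity, vanishing on \<open>kern\<close> and the delta property
    then follow by exhibiting suitable expansions.\<close>
  have g_eqI: "g i p = c i"
    if "cong p (\<Sum>i<m. Poly_Mapping.single 0 (c i) * b i)" "i < m" for c i p
  proof -
    have "val p = (\<Oplus>\<^bsub>A\<^esub> i\<in>{..<m}. c i \<odot>\<^bsub>A\<^esub> val (b i))"
      using that(1) by (simp add: finsum_scale_val cong_iff)
    also have "\<dots> = (\<Oplus>\<^bsub>A\<^esub> i\<in>{..<m}. vec m c $ i \<odot>\<^bsub>A\<^esub> bs ! i)"
      by (rule A.M.finsum_cong') (simp_all add: b)
    finally have eq: "val p = (\<Oplus>\<^bsub>A\<^esub> i\<in>{..<m}. vec m c $ i \<odot>\<^bsub>A\<^esub> bs ! i)" .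
    have "coords A bs (val p) = vec m c"
      using coords_eqI[OF basis, folded m_def, OF vec_carrier eq val_closed] .
    then show ?thesis
      using that(2) by (simp add: g_def)
  qed
  have expand: "cong p (\<Sum>i<m. Poly_Mapping.single 0 (g i p) * b i)" for p
  proof -
    have "val p = (\<Oplus>\<^bsub>A\<^esub> i\<in>{..<m}. coords A bs (val p) $ i \<odot>\<^bsub>A\<^esub> bs ! i)"
      unfolding m_def by (rule coords_unfold[OF basis]) simp
    also have "\<dots> = (\<Oplus>\<^bsub>A\<^esub> i\<in>{..<m}. g i p \<odot>\<^bsub>A\<^esub> val (b i))"
      by (rule A.M.finsum_cong') (simp_all add: b g_def)
    finally show ?thesis
      by (simp add: finsum_scale_val cong_iff)
  qed
  have "quotient_basis m b g"
    unfolding quotient_basis_def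
  proof (intro conjI allI impI)
    fix i
    assume i: "i < m"
    have "g i (p + q) = g i p + g i q" for p q
      using cong_add[OF expand[of p] expand[of q]] i
      by (intro g_eqI) (simp_all add: single_add distrib_right sum.distrib)
    moreover have "g i (Poly_Mapping.single 0 c * p) = c * g i p" for c p
      using cong_mult_left[OF expand[of p], of "Poly_Mapping.single 0 c"] i
      by (intro g_eqI) (simp_all add: sum_distrib_left mult_single mult.assoc[symmetric])
    moreover have "g i p = 0" if "p \<in> kern" for p
      using that i by (intro g_eqI) (simp_all add: cong_def)
    ultimately show "g i \<in> dual"
      by (simp add: dual_def)
    fix j
    assume j: "j < m"
    have "(\<Sum>i<m. Poly_Mapping.single 0 (if i = j then 1 else 0) * b i) =
        (\<Sum>i<m. if i = j then b i else 0)"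
      by (intro sum.cong) simp_all
    then show "g i (b j) = (if i = j then 1 else 0)"
      using i j by (intro g_eqI) simp_all
  qed (rule expand)
  moreover have "alg_disc A bs = disc m b g"
    by (intro alg_disc_eq[OF basis m_def[symmetric] b]) (simp_all add: g_def)
  ultimately show ?thesis
    by (intro exI conjI)
qed

lemma trace_etale_iff: "trace_etale A \<longleftrightarrow> (\<exists>m b g. quotient_basis m b g \<and> disc m b g \<noteq> 0)"
proof
  assume "trace_etale A"
  then obtain bs where bs: "finite_basis A bs" "alg_disc A bs dvd 1"
    by (auto simp: trace_etale_def)
  then show "\<exists>m b g. quotient_basis m b g \<and> disc m b g \<noteq> 0"
    using finite_basis_imp_quotient_basis[OF bs(1)] by (metis dvd_0_left zero_neq_one)
next
  assume "\<exists>m b g. quotient_basis m b g \<and> disc m b g \<noteq> 0"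
  then obtain m b g where qb: "quotient_basis m b g" and disc: "disc m b g \<noteq> 0" by blast
  obtain bs where "finite_basis A bs" "alg_disc A bs = disc m b g"
    using quotient_basis_imp_finite_basis[OF qb] by blast
  then show "trace_etale A"
    using disc by (auto simp: trace_etale_def dvd_field_iff)
qed

end

theorem mainTheorem1:
  fixes A :: "('k :: field, 'a) module"
    and n :: nat
    and fs :: "'k mpol list"
    and \<phi> :: "'k mpol set \<Rightarrow> 'a"
  assumes "presentation A n fs \<phi>"
  shows "(net A n fs \<phi> \<longrightarrow> strictly_finite A \<and> trace_etale A) \<and>
         (net A n fs \<phi> \<longleftrightarrow> trace_etale A)"
proof -
  interpret presented_algebra A n fs \<phi>
    by unfold_locales (rule assms)
  have "net A n fs \<phi> \<longleftrightarrow> trace_etale A"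
    unfolding net_iff_disc_nonzero trace_etale_iff ..
  moreover have "trace_etale A \<longrightarrow> strictly_finite A"
    by (auto simp: trace_etale_def strictly_finite_def)
  ultimately show ?thesis by blast
qed

end
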